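(* Let $F$ be a non-trivial (i.e. $k\notin\{1,n-1\}$) $(n,k)$-frame. Then $F$ is $4_c$-uniform if and only if its Seidel matrix is switching equivalent to $$\begin{bmatrix}0&1&1&1\\1&0&-i&i\\1&i&0&-i\\1&-i&i&0\end{bmatrix}.$$
   Context: An $(n,k)$-frame is a Parseval frame $\{f_i\}_{i=1}^n$ for $\mathbb{F}^k$, $\mathbb{F}\in\{\mathbb{R},\mathbb{C}\}$, with analysis operator $V$, $Vx=(\langle x,f_i\rangle)_{i=1}^n$. Let $\mathcal{D}_m$ be the set of $n\times n$ diagonal matrices with exactly $m$ diagonal entries equal to $1$ and the rest $0$. $F$ is $m$-uniform if $\|V^*DV\|$ (operator norm) is the same for all $D\in\mathcal{D}_m$, and $m_c$-uniform if it is $\ell$-uniform for all $\ell=1,\dots,m$. A $2_c$-uniform frame is an equiangular Parseval frame and its Seidel matrix $Q$ is defined by $VV^*=\frac{k}{n}I+c_{n,k}Q$ with $c_{n,k}=\sqrt{\frac{k(n-k)}{n^2(n-1)}}$. Two Seidel matrices $Q,S$ are switching equivalent if $Q=PDSD^{-1}P^{-1}$ with $P$ a permutation matrix and $D$ diagonal with unimodular diagonal entries.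
   Formalization: The formal theorem also assumes k < n: for k = n (an orthonormal basis) c_{n,k} = 0, so the Seidel matrix is undefined, and e.g. an orthonormal basis of C^5 is 4_c-uniform although no 5×5 matrix is switching equivalent to the given one. *)

theory Defs
  imports "HOL-Analysis.Analysis"
begin

(* Frames are indexed by a finite type 'n (n = CARD('n)) and live in F^k with
   k = CARD('k).  Vectors are 'a^'k with the Euclidean (l2) norm. *)

definition cip :: "complex^'k \<Rightarrow> complex^'k \<Rightarrow> complex" where
  "cip x y = (\<Sum>j\<in>UNIV. x$j * cnj (y$j))"

(* analysis operator V x = (<x, f_i>)_i *)
definition analysis_c :: "('n \<Rightarrow> complex^'k) \<Rightarrow> complex^'k^'n" where
  "analysis_c f = (\<chi> i j. cnj (f i $ j))"

definition cadj :: "complex^'b^'a \<Rightarrow> complex^'a^'b" where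
  "cadj M = (\<chi> i j. cnj (M$j$i))"

definition parseval_c :: "('n::finite \<Rightarrow> complex^'k::finite) \<Rightarrow> bool" where
  "parseval_c f \<longleftrightarrow> (\<forall>x. (\<Sum>i\<in>UNIV. (cmod (cip x (f i)))^2) = (norm x)^2)"

definition sel_diag :: "'n set \<Rightarrow> 'a::zero_neq_one^'n^'n" where
  "sel_diag A = (\<chi> i j. if i = j \<and> i \<in> A then 1 else 0)"

definition uniform_c :: "nat \<Rightarrow> ('n::finite \<Rightarrow> complex^'k::finite) \<Rightarrow> bool" where
  "uniform_c m f \<longleftrightarrow>
     (\<forall>A B. card A = m \<longrightarrow> card B = m \<longrightarrow>
        onorm (\<lambda>x. (cadj (analysis_c f) ** sel_diag A ** analysis_c f) *v x)
      = onorm (\<lambda>x. (cadj (analysis_c f) ** sel_diag B ** analysis_c f) *v x))"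

definition uniform_upto_c :: "nat \<Rightarrow> ('n::finite \<Rightarrow> complex^'k::finite) \<Rightarrow> bool" where
  "uniform_upto_c m f \<longleftrightarrow> (\<forall>l\<in>{1..m}. uniform_c l f)"

definition c_nk :: "nat \<Rightarrow> nat \<Rightarrow> real" where
  "c_nk n k = sqrt (real k * (real n - real k) / ((real n)^2 * (real n - 1)))"

(* Seidel matrix Q:  V V^* = (k/n) I + c_{n,k} Q *)
definition seidel_c :: "('n::finite \<Rightarrow> complex^'k::finite) \<Rightarrow> complex^'n^'n" where
  "seidel_c f = (\<chi> i j.
     ((analysis_c f ** cadj (analysis_c f))$i$j
        - (if i = j then complex_of_real (real CARD('k) / real CARD('n)) else 0))
     / complex_of_real (c_nk CARD('n) CARD('k)))"

definition analysis_r :: "('n \<Rightarrow> real^'k) \<Rightarrow> real^'k^'n" where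
  "analysis_r f = (\<chi> i j. f i $ j)"

definition parseval_r :: "('n::finite \<Rightarrow> real^'k::finite) \<Rightarrow> bool" where
  "parseval_r f \<longleftrightarrow> (\<forall>x. (\<Sum>i\<in>UNIV. (x \<bullet> f i)^2) = (norm x)^2)"

definition uniform_r :: "nat \<Rightarrow> ('n::finite \<Rightarrow> real^'k::finite) \<Rightarrow> bool" where
  "uniform_r m f \<longleftrightarrow>
     (\<forall>A B. card A = m \<longrightarrow> card B = m \<longrightarrow>
        onorm (\<lambda>x. (transpose (analysis_r f) ** sel_diag A ** analysis_r f) *v x)
      = onorm (\<lambda>x. (transpose (analysis_r f) ** sel_diag B ** analysis_r f) *v x))"

definition uniform_upto_r :: "nat \<Rightarrow> ('n::finite \<Rightarrow> real^'k::finite) \<Rightarrow> bool" where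
  "uniform_upto_r m f \<longleftrightarrow> (\<forall>l\<in>{1..m}. uniform_r l f)"

definition seidel_r :: "('n::finite \<Rightarrow> real^'k::finite) \<Rightarrow> real^'n^'n" where
  "seidel_r f = (\<chi> i j.
     ((analysis_r f ** transpose (analysis_r f))$i$j
        - (if i = j then real CARD('k) / real CARD('n) else 0))
     / c_nk CARD('n) CARD('k))"

definition cmat_of_real :: "real^'b^'a \<Rightarrow> complex^'b^'a" where
  "cmat_of_real M = (\<chi> i j. complex_of_real (M$i$j))"

definition switching_equiv :: "complex^'n^'n \<Rightarrow> complex^'m^'m \<Rightarrow> bool" where
  "switching_equiv Q S \<longleftrightarrow>
     (\<exists>(P::complex^'m^'n) (D::complex^'m^'m).
        (\<exists>\<sigma>::'n \<Rightarrow> 'm. bij \<sigma> \<and> P = (\<chi> i j. if j = \<sigma> i then 1 else 0)) \<and>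
        (\<exists>d. (\<forall>i. cmod (d i) = 1) \<and> D = (\<chi> i j. if i = j then d i else 0)) \<and>
        Q = P ** D ** S ** matrix_inv D ** matrix_inv P)"

definition idx4 :: "4 \<Rightarrow> nat" where
  "idx4 i = (if i = 0 then 0 else if i = 1 then 1 else if i = 2 then 2 else 3)"

definition seidel4 :: "complex^4^4" where
  "seidel4 = (\<chi> i j.
     [[0, 1, 1, 1],
      [1, 0, -\<i>, \<i>],
      [1, \<i>, 0, -\<i>],
      [1, -\<i>, \<i>, 0]] ! idx4 i ! idx4 j)"

end

theory Submission
  imports Defs
begin

text \<open>
  The norm of \<open>V\<^sup>*DV\<close> is the largest eigenvalue of the Gram block selected by \<open>D\<close>. Hence a
  \<open>2\<^sub>c\<close>-uniform frame is equiangular, and 3-uniformity makes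
  \<open>Re (Q\<^sub>i\<^sub>j Q\<^sub>j\<^sub>k Q\<^sub>k\<^sub>i)\<close> a constant \<open>r\<close>, because an eigenvalue \<open>\<lambda>\<close> of a \<open>3 \<times> 3\<close> block satisfies
  \<open>\<lambda>\<^sup>3 - 3\<lambda> = 2r\<close>. Switch so that row \<open>p\<close> of \<open>Q\<close> consists of ones; the other off-diagonal
  entries become \<open>r \<plusminus> is\<close> with \<open>r\<^sup>2 + s\<^sup>2 = 1\<close>. Row \<open>p\<close> of \<open>Q\<^sup>2 = (n - 1) I + \<mu> Q\<close> gives
  \<open>\<mu> = (n - 2) r\<close> and says that the signs form a regular tournament. If \<open>s = 0\<close> the frame is trivial.
  Otherwise a regular tournament has a cyclic triple, whose triple product forces \<open>r = 0\<close>. The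
  eigenvalues of the \<open>4 \<times> 4\<close> block on \<open>p\<close> and a triple satisfy \<open>\<lambda>\<^sup>2 = 3\<close> for a cyclic triple and
  \<open>\<lambda>\<^sup>4 - 6\<lambda>\<^sup>2 + 1 = 0\<close> for a transitive one, so 4-uniformity excludes transitive triples; these
  exist as soon as \<open>n \<ge> 5\<close>. For \<open>n = 4\<close> the regular tournament is a 3-cycle, which is the given
  matrix. Conversely, for \<open>n = 4\<close> and \<open>k = 2\<close> an equiangular frame is 3-uniform since some unit vector
  is orthogonal to the omitted frame vector, so that each of these norms is 1. Real frames are
  complexified; this changes neither the Gram matrix nor the norms.
\<close>

section \<open>Eigenvalues of blocks of Seidel matrices\<close>

definition seidel_like :: "('n \<Rightarrow> 'n \<Rightarrow> complex) \<Rightarrow> bool" where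
  "seidel_like Q \<longleftrightarrow>
     (\<forall>i. Q i i = 0) \<and> (\<forall>i j. i \<noteq> j \<longrightarrow> cmod (Q i j) = 1) \<and> (\<forall>i j. Q j i = cnj (Q i j))"

text \<open>Only the values of \<open>y\<close> on \<open>A\<close> matter, so this speaks of the
  principal submatrix on \<open>A\<close> without an index type for \<open>A\<close>.\<close>

definition block_eigenvalue :: "('n \<Rightarrow> 'n \<Rightarrow> complex) \<Rightarrow> 'n set \<Rightarrow> real \<Rightarrow> bool" where
  "block_eigenvalue Q A l \<longleftrightarrow>
     (\<exists>y. (\<exists>i\<in>A. y i \<noteq> 0) \<and> (\<forall>i\<in>A. (\<Sum>j\<in>A. Q i j * y j) = complex_of_real l * y i))"

lemma unimodular_mult_cnj: "cmod z = 1 \<Longrightarrow> z * cnj z = 1"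
  by (simp add: complex_norm_square[symmetric])

text \<open>Conjugation by a diagonal unitary carries an eigenvector \<open>y\<close> to
  \<open>\<lambda>i. d i * y i\<close>.\<close>

lemma block_eigenvalue_switch:
  assumes "\<And>i. cmod (d i) = 1" and "block_eigenvalue Q A l"
  shows "block_eigenvalue (\<lambda>i j. d i * Q i j * cnj (d j)) A l"
proof -
  obtain y where y: "\<exists>i\<in>A. y i \<noteq> 0"
    "\<And>i. i \<in> A \<Longrightarrow> (\<Sum>j\<in>A. Q i j * y j) = complex_of_real l * y i"
    using assms(2) unfolding block_eigenvalue_def by auto
  have d: "cnj (d j) * d j = 1" for j
    using unimodular_mult_cnj[OF assms(1)] by (simp add: mult.commute)
  have nz: "d j \<noteq> 0" for j using assms(1)[of j] by auto
  have "(\<Sum>j\<in>A. d i * Q i j * cnj (d j) * (d j * y j)) = complex_of_real l * (d i * y i)"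
    if "i \<in> A" for i
  proof -
    have "(\<Sum>j\<in>A. d i * Q i j * cnj (d j) * (d j * y j)) = (\<Sum>j\<in>A. d i * (Q i j * y j))"
    proof (rule sum.cong[OF refl])
      fix j
      have "d i * Q i j * cnj (d j) * (d j * y j) = d i * Q i j * (cnj (d j) * d j) * y j"
        by (simp add: mult_ac)
      then show "d i * Q i j * cnj (d j) * (d j * y j) = d i * (Q i j * y j)"
        by (simp add: d)
    qed
    also have "\<dots> = d i * (complex_of_real l * y i)"
      using y(2)[OF that] by (simp add: sum_distrib_left[symmetric])
    finally show ?thesis by (simp add: mult_ac)
  qed
  then show ?thesis
    unfolding block_eigenvalue_def using y(1) nz by (intro exI[of _ "\<lambda>i. d i * y i"]) auto
qed

text \<open>The equation is the characteristic equation of the block: unimodularity fixes the linear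
  coefficient, and the determinant is twice the real part of the triple product.\<close>

lemma block_eigenvalue_triple:
  assumes Q: "seidel_like Q" and ne: "i \<noteq> j" "j \<noteq> k" "i \<noteq> k"
    and ev: "block_eigenvalue Q {i,j,k} l"
  shows "l ^ 3 - 3 * l = 2 * Re (Q i j * Q j k * Q k i)"
proof -
  obtain y where y: "\<exists>i\<in>{i,j,k}. y i \<noteq> 0"
    "\<And>m. m \<in> {i,j,k} \<Longrightarrow> (\<Sum>p\<in>{i,j,k}. Q m p * y p) = complex_of_real l * y m"
    using ev unfolding block_eigenvalue_def by auto
  define u v w L where "u = Q i j" "v = Q j k" "w = Q k i" "L = complex_of_real l"
  \<comment> \<open>The conjugates get names of their own, tied to \<open>u\<close>,
    \<open>v\<close>, \<open>w\<close> only by products equal to 1, so that the elimination is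
    purely polynomial.\<close>
  define u' v' w' where "u' = cnj u" "v' = cnj v" "w' = cnj w"
  note defs = \<open>u = Q i j\<close> \<open>v = Q j k\<close> \<open>w = Q k i\<close> \<open>u' = cnj u\<close> \<open>v' = cnj v\<close> \<open>w' = cnj w\<close> \<open>L = _\<close>
  have sym: "Q j i = u'" "Q k j = v'" "Q i k = w'" and diag: "Q i i = 0" "Q j j = 0" "Q k k = 0"
    using Q unfolding seidel_like_def defs by metis+
  have one: "u * u' = 1" "v * v' = 1" "w * w' = 1"
    using Q ne unimodular_mult_cnj unfolding seidel_like_def defs by metis+
  have e: "u * y j + w' * y k = L * y i" "u' * y i + v * y k = L * y j" "w * y i + v' * y j = L * y k"
    using y(2)[of i] y(2)[of j] y(2)[of k] ne
    by (simp_all add: sym diag defs(1-3)[symmetric] \<open>L = _\<close>)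
  \<comment> \<open>Elimination shows that the characteristic polynomial annihilates every
    coordinate of \<open>y\<close>, one of which is nonzero.\<close>
  have "(L^3 - 3 * L - (u * v * w + u' * v' * w')) * y i = 0"
       "(L^3 - 3 * L - (u * v * w + u' * v' * w')) * y j = 0"
       "(L^3 - 3 * L - (u * v * w + u' * v' * w')) * y k = 0"
    using e one by algebra+
  then have "L^3 - 3 * L - (u * v * w + u' * v' * w') = 0"
    using y(1) by auto
  then have "L^3 - 3 * L = u * v * w + cnj (u * v * w)"
    by (simp add: \<open>u' = _\<close> \<open>v' = _\<close> \<open>w' = _\<close>)
  then have "Re (L^3 - 3 * L) = 2 * Re (u * v * w)" by (simp only: complex_add_cnj) simp
  moreover have "L^3 - 3 * L = complex_of_real (l^3 - 3 * l)" by (simp add: \<open>L = _\<close>)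
  ultimately show ?thesis unfolding defs by (simp only: Re_complex_of_real)
qed

text \<open>This block is a Hermitian conference matrix of order 4: its square is 3 times the
  identity.\<close>

lemma block_eigenvalue_cyclic:
  assumes Q: "seidel_like Q" and ne: "distinct [p, a, b, c]"
    and one: "Q p a = 1" "Q p b = 1" "Q p c = 1"
    and cyc: "Q a b = \<i>" "Q b c = \<i>" "Q c a = \<i>"
    and ev: "block_eigenvalue Q {p,a,b,c} l"
  shows "l ^ 2 = 3"
proof -
  obtain y where y: "\<exists>i\<in>{p,a,b,c}. y i \<noteq> 0"
    "\<And>m. m \<in> {p,a,b,c} \<Longrightarrow> (\<Sum>p\<in>{p,a,b,c}. Q m p * y p) = complex_of_real l * y m"
    using ev unfolding block_eigenvalue_def by auto
  define L where "L = complex_of_real l"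
  have h: "Q q p = cnj (Q p q)" "Q p p = 0" for p q using Q unfolding seidel_like_def by blast+
  have sym: "Q a p = 1" "Q b p = 1" "Q c p = 1" "Q b a = - \<i>" "Q c b = - \<i>" "Q a c = - \<i>"
    by (subst h(1), simp add: one cyc)+
  \<comment> \<open>\<open>I\<close> acts as an indeterminate known only through
    \<open>I * I = -1\<close>.\<close>
  define I where "I = \<i>"
  have I: "I * I = -1" by (simp add: I_def)
  have e: "y a + y b + y c = L * y p" "y p + I * y b - I * y c = L * y a"
     "y p - I * y a + I * y c = L * y b" "y p + I * y a - I * y b = L * y c"
    using y(2)[of p, symmetric] y(2)[of a, symmetric] y(2)[of b, symmetric] y(2)[of c, symmetric] ne
    unfolding L_def I_def by (simp_all add: sym h(2) one cyc)
  have "(L^2 - 3) * y p = 0" "(L^2 - 3) * y a = 0" "(L^2 - 3) * y b = 0" "(L^2 - 3) * y c = 0"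
    using e I by algebra+
  then have "L^2 - 3 = 0" using y(1) by auto
  moreover have "L^2 - 3 = complex_of_real (l^2 - 3)" by (simp add: L_def)
  ultimately show ?thesis by (simp only: of_real_eq_0_iff)
qed

text \<open>The quartic is the characteristic polynomial of the block; all triple products are
  imaginary, so it has no odd terms. At \<open>l^2 = 3\<close> it takes the value -8, which
  separates this block from the cyclic one.\<close>

lemma block_eigenvalue_transitive:
  assumes Q: "seidel_like Q" and ne: "distinct [p, a, b, c]"
    and one: "Q p a = 1" "Q p b = 1" "Q p c = 1"
    and tr: "Q a b = \<i>" "Q b c = \<i>" "Q a c = \<i>"
    and ev: "block_eigenvalue Q {p,a,b,c} l"
  shows "l ^ 4 - 6 * l ^ 2 + 1 = 0"
proof -
  obtain y where y: "\<exists>i\<in>{p,a,b,c}. y i \<noteq> 0"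
    "\<And>m. m \<in> {p,a,b,c} \<Longrightarrow> (\<Sum>p\<in>{p,a,b,c}. Q m p * y p) = complex_of_real l * y m"
    using ev unfolding block_eigenvalue_def by auto
  define L where "L = complex_of_real l"
  have h: "Q q p = cnj (Q p q)" "Q p p = 0" for p q using Q unfolding seidel_like_def by blast+
  have sym: "Q a p = 1" "Q b p = 1" "Q c p = 1" "Q b a = - \<i>" "Q c b = - \<i>" "Q c a = - \<i>"
    by (subst h(1), simp add: one tr)+
  define I where "I = \<i>"
  have I: "I * I = -1" by (simp add: I_def)
  have e: "y a + y b + y c = L * y p" "y p + I * y b + I * y c = L * y a"
     "y p - I * y a + I * y c = L * y b" "y p - I * y a - I * y b = L * y c"
    using y(2)[of p, symmetric] y(2)[of a, symmetric] y(2)[of b, symmetric] y(2)[of c, symmetric] ne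
    unfolding L_def I_def by (simp_all add: sym h(2) one tr)
  have "(L^4 - 6 * L^2 + 1) * y p = 0" "(L^4 - 6 * L^2 + 1) * y a = 0"
       "(L^4 - 6 * L^2 + 1) * y b = 0" "(L^4 - 6 * L^2 + 1) * y c = 0"
    using e I by algebra+
  then have "L^4 - 6 * L^2 + 1 = 0" using y(1) by auto
  moreover have "L^4 - 6 * L^2 + 1 = complex_of_real (l^4 - 6 * l^2 + 1)" by (simp add: L_def)
  ultimately show ?thesis by (simp only: of_real_eq_0_iff)
qed

section \<open>Regular tournaments and normalized Seidel matrices\<close>

lemma regular_tournament_cyclic_triple:
  fixes e :: "'v \<Rightarrow> 'v \<Rightarrow> bool"
  assumes fin: "finite S"
    and tour: "\<And>a b. a \<in> S \<Longrightarrow> b \<in> S \<Longrightarrow> a \<noteq> b \<Longrightarrow> e a b \<longleftrightarrow> \<not> e b a"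
    and reg: "\<And>a. a \<in> S \<Longrightarrow> card {x \<in> S - {a}. e a x} = d"
    and ab: "a \<in> S" "b \<in> S" "a \<noteq> b" "e a b"
  obtains c where "c \<in> S" "c \<noteq> a" "c \<noteq> b" "e b c" "e c a"
proof -
  have "\<exists>c\<in>S. c \<noteq> a \<and> c \<noteq> b \<and> e b c \<and> e c a"
  proof (rule ccontr)
    assume no: "\<not> ?thesis"
    \<comment> \<open>Without such a \<open>c\<close>, every out-neighbour of \<open>b\<close> is an
      out-neighbour of \<open>a\<close>; as \<open>b\<close> itself is one more, \<open>a\<close>
      would have the larger out-degree.\<close>
    have sub: "x \<noteq> a \<and> e a x" if "x \<in> S" "x \<noteq> b" "e b x" for x
    proof
      show "x \<noteq> a" using that ab tour[of a b] by metis
      then show "e a x" using no that ab tour[of a x] by metis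
    qed
    have "b \<in> {x \<in> S - {a}. e a x}" "b \<notin> {x \<in> S - {b}. e b x}" using ab by simp_all
    moreover have "{x \<in> S - {b}. e b x} \<subseteq> {x \<in> S - {a}. e a x}" using sub by simp blast
    ultimately have "{x \<in> S - {b}. e b x} \<subset> {x \<in> S - {a}. e a x}" by blast
    then have "card {x \<in> S - {b}. e b x} < card {x \<in> S - {a}. e a x}"
      using fin by (intro psubset_card_mono) auto
    then show False using reg ab by simp
  qed
  then show ?thesis using that by blast
qed

text \<open>With row \<open>p\<close> normalized, \<open>Re (R a b)\<close> is itself the real part
  of a triple product, so all entries off \<open>p\<close> share one real part \<open>r\<close>. The
  assumption on \<open>\<mu>\<close> excludes \<open>r^2 = 1\<close>, where \<open>R\<close> would
  be real; the triple product at a cyclic triple then leaves only \<open>r = 0\<close>.\<close>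

lemma normalized_seidel_like_regular:
  fixes R :: "'n::finite \<Rightarrow> 'n \<Rightarrow> complex"
  assumes R: "seidel_like R" and one: "\<And>j. j \<noteq> p \<Longrightarrow> R p j = 1"
    and sq: "\<And>a. a \<noteq> p \<Longrightarrow> (\<Sum>j\<in>UNIV. R a j * R j p) = complex_of_real \<mu> * R a p"
    and ev3: "\<And>A. card A = 3 \<Longrightarrow> block_eigenvalue R A l3"
    and n: "CARD('n) \<ge> 4" and mu: "\<mu>^2 \<noteq> (real CARD('n) - 2)^2"
  shows "\<And>a b. a \<noteq> p \<Longrightarrow> b \<noteq> p \<Longrightarrow> a \<noteq> b \<Longrightarrow> R a b = \<i> \<or> R a b = - \<i>"
    and "\<And>a. a \<noteq> p \<Longrightarrow> 2 * card {x. x \<noteq> p \<and> x \<noteq> a \<and> R a x = \<i>} = CARD('n) - 2"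
    and "\<exists>a b c. distinct [p,a,b,c] \<and> R a b = \<i> \<and> R b c = \<i> \<and> R c a = \<i>"
proof -
  define r where "r = (l3^3 - 3 * l3) / 2"
  define s where "s = sqrt (1 - r^2)"
  have herm: "R j i = cnj (R i j)" and diag: "R i i = 0" for i j
    using R unfolding seidel_like_def by blast+
  have mod1: "cmod (R i j) = 1" if "i \<noteq> j" for i j
    using R that unfolding seidel_like_def by blast
  have one': "R j p = 1" if "j \<noteq> p" for j
    using herm[of j p] one[OF that] by simp
  have trip: "Re (R i j * R j k * R k i) = r" if "i \<noteq> j" "j \<noteq> k" "i \<noteq> k" for i j k
  proof -
    have "card {i,j,k} = 3" using that by simp
    from block_eigenvalue_triple[OF R that ev3[OF this]] show ?thesis by (simp add: r_def)
  qed
  have re: "Re (R a b) = r" if "a \<noteq> p" "b \<noteq> p" "a \<noteq> b" for a b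
    using trip[of p a b] that by (simp add: one one')
  have im2: "(Im (R a b))^2 = 1 - r^2" if "a \<noteq> p" "b \<noteq> p" "a \<noteq> b" for a b
    using mod1[of a b] re[OF that] that cmod_power2[of "R a b"] by simp
  \<comment> \<open>Column \<open>p\<close> consists of ones, and the terms at \<open>p\<close> and
    at \<open>a\<close> contain a diagonal zero, so \<open>sq\<close> becomes a row sum.\<close>
  have row: "(\<Sum>x\<in>UNIV - {p,a}. R a x) = complex_of_real \<mu>" if a: "a \<noteq> p" for a
  proof -
    have "(\<Sum>j\<in>UNIV. R a j * R j p) = (\<Sum>j\<in>UNIV - {p,a}. R a j * R j p)"
      by (rule sum.mono_neutral_right) (auto simp: diag)
    also have "\<dots> = (\<Sum>j\<in>UNIV - {p,a}. R a j)"
      by (rule sum.cong) (auto simp: one')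
    finally show ?thesis using sq[OF a] one'[OF a] by simp
  qed
  have card2: "card (UNIV - {p,a}) = CARD('n) - 2" if "a \<noteq> p" for a
    using that by (simp add: card_Diff_subset)
  obtain a0 where a0: "a0 \<noteq> p"
  proof -
    have "\<not> (UNIV::'n set) \<subseteq> {p}" using n card_mono[of "{p}" "UNIV::'n set"] by auto
    then show ?thesis using that by blast
  qed
  \<comment> \<open>Real part of the row sum: \<open>n - 2\<close> equal terms
    \<open>r\<close>.\<close>
  have mu_r: "\<mu> = (real CARD('n) - 2) * r"
  proof -
    have "\<mu> = (\<Sum>x\<in>UNIV - {p,a0}. Re (R a0 x))"
      using arg_cong[OF row[OF a0], of Re] by simp
    also have "\<dots> = (\<Sum>x\<in>UNIV - {p,a0}. r)"
      by (rule sum.cong) (use re a0 in auto)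
    also have "\<dots> = real (CARD('n) - 2) * r" using card2[OF a0] by simp
    finally show ?thesis using n by (simp add: of_nat_diff)
  qed
  have r1: "r^2 \<noteq> 1" using mu unfolding mu_r by (auto simp: power_mult_distrib)
  have rle: "r^2 < 1"
  proof -
    have "\<exists>b. b \<noteq> p \<and> b \<noteq> a0"
    proof (rule ccontr)
      assume "\<not> ?thesis"
      then have "UNIV - {p,a0} = {}" by auto
      then have "card (UNIV - {p,a0}) = 0" by (simp only: card.empty)
      then show False using card2[OF a0] n by linarith
    qed
    then obtain b where "b \<noteq> p" "a0 \<noteq> b" by auto
    from im2[OF a0 this] have "1 - r^2 \<ge> 0" by (metis zero_le_power2)
    with r1 show ?thesis by simp
  qed
  have s: "s > 0" "s^2 = 1 - r^2" using rle by (simp_all add: s_def)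
  have im: "Im (R a b) = s \<or> Im (R a b) = - s" if "a \<noteq> p" "b \<noteq> p" "a \<noteq> b" for a b
    using im2[OF that] s(2) power2_eq_iff[of "Im (R a b)" s] by simp
  \<comment> \<open>The sign of the imaginary part orients the pair \<open>a\<close>,
    \<open>b\<close>; Hermitian symmetry makes this a tournament off \<open>p\<close>.\<close>
  define e where "e = (\<lambda>a b. Im (R a b) > 0)"
  have e: "Im (R a b) = (if e a b then s else - s)" if "a \<noteq> p" "b \<noteq> p" "a \<noteq> b" for a b
    using im[OF that] s(1) by (auto simp: e_def)
  have tour: "e a b \<longleftrightarrow> \<not> e b a" if "a \<in> UNIV - {p}" "b \<in> UNIV - {p}" "a \<noteq> b" for a b
    using im[of a b] herm[of a b] s(1) that unfolding e_def by auto
  \<comment> \<open>Since \<open>\<mu>\<close> is real, the imaginary parts in a row cancel, so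
    \<open>s\<close> and \<open>- s\<close> occur equally often among the \<open>n - 2\<close>
    entries.\<close>
  have reg: "2 * card {x \<in> UNIV - {p} - {a}. e a x} = CARD('n) - 2" if a: "a \<noteq> p" for a
  proof -
    let ?X = "UNIV - {p,a}"
    let ?P = "{x \<in> ?X. e a x}" and ?N = "{x \<in> ?X. \<not> e a x}"
    have "0 = (\<Sum>x\<in>?X. Im (R a x))"
      using arg_cong[OF row[OF a], of Im] by simp
    also have "\<dots> = (\<Sum>x\<in>?X. if e a x then s else - s)"
      by (rule sum.cong) (use e a in auto)
    also have "\<dots> = s * (real (card ?P) - real (card ?N))"
      by (simp add: sum.If_cases Int_def algebra_simps)
    finally have "card ?P = card ?N" using s(1) by simp
    moreover have "card ?P + card ?N = card (?P \<union> ?N)"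
      by (rule card_Un_disjoint[symmetric]) auto
    moreover have "?P \<union> ?N = ?X" by auto
    ultimately have "2 * card ?P = CARD('n) - 2" using card2[OF a] by simp
    moreover have "UNIV - {p} - {a} = ?X" by auto
    ultimately show ?thesis by simp
  qed
  have "card {x \<in> UNIV - {p} - {a0}. e a0 x} \<noteq> 0"
    using reg[OF a0] n by linarith
  then obtain b where b: "b \<noteq> p" "b \<noteq> a0" "e a0 b" by (auto simp: card_eq_0_iff)
  have reg': "card {x \<in> UNIV - {p} - {a}. e a x} = (CARD('n) - 2) div 2" if "a \<in> UNIV - {p}" for a
    using reg[of a] that by simp
  have "a0 \<in> UNIV - {p}" "b \<in> UNIV - {p}" "a0 \<noteq> b" using a0 b by auto
  from regular_tournament_cyclic_triple[OF finite tour reg' this b(3)]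
  obtain c where "c \<in> UNIV - {p}" "c \<noteq> a0" "c \<noteq> b" "e b c" "e c a0" .
  then have c: "c \<noteq> p" "c \<noteq> a0" "c \<noteq> b" "e b c" "e c a0" by simp_all
  define z where "z = Complex r s"
  have cyc: "R a0 b = z" "R b c = z" "R c a0 = z"
    using re e a0 b c by (auto simp: z_def complex_eq_iff)
  \<comment> \<open>Around a cyclic triple all three factors equal \<open>z\<close>, and
    \<open>Re (z^3) = r\<close> together with \<open>s^2 = 1 - r^2\<close> amounts to
    \<open>4 * r * (r^2 - 1) = 0\<close>.\<close>
  have "Re (z * z * z) = r" using trip[of a0 b c] b c cyc by auto
  then have "r * (r^2 - 3 * s^2) = r"
    by (simp add: z_def power2_eq_square algebra_simps)
  then have "r * (1 - r^2) = 0" unfolding s(2) by (simp add: algebra_simps)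
  then have r0: "r = 0" using r1 by simp
  then have s1: "s = 1" by (simp add: s_def)
  show "R a b = \<i> \<or> R a b = - \<i>" if "a \<noteq> p" "b \<noteq> p" "a \<noteq> b" for a b
    using re[OF that] im[OF that] r0 s1 by (auto simp: complex_eq_iff)
  show "2 * card {x. x \<noteq> p \<and> x \<noteq> a \<and> R a x = \<i>} = CARD('n) - 2" if a: "a \<noteq> p" for a
  proof -
    have "{x. x \<noteq> p \<and> x \<noteq> a \<and> R a x = \<i>} = {x \<in> UNIV - {p} - {a}. e a x}"
      using re e a r0 s1 by (auto simp: complex_eq_iff split: if_splits)
    then show ?thesis using reg[OF a] by simp
  qed
  have "z = \<i>" by (simp add: z_def r0 s1 complex_eq_iff)
  then show "\<exists>a b c. distinct [p,a,b,c] \<and> R a b = \<i> \<and> R b c = \<i> \<and> R c a = \<i>"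
    using cyc a0 b c by (intro exI[of _ a0] exI[of _ b] exI[of _ c]) auto
qed

text \<open>A cyclic triple exists and forces \<open>l4^2 = 3\<close>, which is incompatible with a
  transitive triple. Two out-neighbours of one vertex always form a transitive triple with it, so
  all out-degrees off \<open>p\<close> are at most 1.\<close>

lemma normalized_seidel_like_card_4:
  fixes R :: "'n::finite \<Rightarrow> 'n \<Rightarrow> complex"
  assumes R: "seidel_like R" and one: "\<And>j. j \<noteq> p \<Longrightarrow> R p j = 1"
    and sq: "\<And>a. a \<noteq> p \<Longrightarrow> (\<Sum>j\<in>UNIV. R a j * R j p) = complex_of_real \<mu> * R a p"
    and ev3: "\<And>A. card A = 3 \<Longrightarrow> block_eigenvalue R A l3"
    and ev4: "\<And>A. card A = 4 \<Longrightarrow> block_eigenvalue R A l4"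
    and n: "CARD('n) \<ge> 4" and mu: "\<mu>^2 \<noteq> (real CARD('n) - 2)^2"
  obtains a b c where "distinct [p,a,b,c]" "UNIV = {p,a,b,c}"
    "R a b = \<i>" "R b c = \<i>" "R c a = \<i>"
proof -
  note reg = normalized_seidel_like_regular[OF R one sq ev3 n mu, simplified]
  obtain a b c where abc: "distinct [p,a,b,c]" "R a b = \<i>" "R b c = \<i>" "R c a = \<i>"
    using reg(3) by auto
  have "block_eigenvalue R {p,a,b,c} l4" using abc(1) by (intro ev4) simp
  with abc one have l4: "l4^2 = 3" by (intro block_eigenvalue_cyclic[OF R abc(1)]) auto
  have no_trans: False if d: "distinct [p,u,v,w]" and tr: "R u v = \<i>" "R v w = \<i>" "R u w = \<i>" for u v w
  proof -
    have "block_eigenvalue R {p,u,v,w} l4" using d by (intro ev4) simp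
    with d tr one have "l4^4 - 6 * l4^2 + 1 = 0"
      by (intro block_eigenvalue_transitive[OF R d]) auto
    moreover have "l4^4 = (l4^2)^2" by simp
    ultimately show False unfolding l4 by simp
  qed
  have "\<not> CARD('n) \<ge> 5"
  proof
    assume n5: "CARD('n) \<ge> 5"
    let ?O = "{x. x \<noteq> p \<and> x \<noteq> a \<and> R a x = \<i>}"
    \<comment> \<open>Twice the out-degree is \<open>n - 2\<close>, hence at least 3, and
      integrality gives 2.\<close>
    have "2 \<le> card ?O" using reg(2)[of a] n5 abc(1) by auto
    then obtain u v where uv: "u \<in> ?O" "v \<in> ?O" "u \<noteq> v"
      by (meson card_2_iff' ex_card subsetD)
    then have "R u v = \<i> \<or> R u v = - \<i>" using reg(1) by auto
    moreover have "R v u = cnj (R u v)" using R unfolding seidel_like_def by blast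
    ultimately consider "R u v = \<i>" | "R v u = \<i>" by auto
    then show False
    proof cases
      case 1
      then show False using no_trans[of a u v] uv abc(1) by auto
    next
      case 2
      then show False using no_trans[of a v u] uv abc(1) by auto
    qed
  qed
  then have "card {p,a,b,c} = CARD('n)" using n abc(1) by simp
  then have "{p,a,b,c} = UNIV" by (intro card_subset_eq) simp_all
  then show ?thesis using that abc by metis
qed

section \<open>Norms of partial frame operators\<close>

text \<open>By compactness the norm \<open>N\<close> is attained at a unit vector \<open>x\<close>.
  Expanding \<open>T (T x) - N^2 x\<close> in norm shows that it vanishes, that is,
  \<open>(T - N) (T + N) x = 0\<close>.\<close>

lemma onorm_positive_eigenvector:
  fixes T :: "'a::euclidean_space \<Rightarrow> 'a"
  assumes lin: "linear T" and sym: "\<And>x y. T x \<bullet> y = x \<bullet> T y" and pos: "\<And>x. T x \<bullet> x \<ge> 0"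
  obtains z where "z \<noteq> 0" "T z = onorm T *\<^sub>R z"
proof -
  let ?N = "onorm T"
  have bl: "bounded_linear T" using lin by (rule linear_conv_bounded_linear[THEN iffD1])
  have "\<exists>x\<in>sphere 0 1. \<forall>y\<in>sphere (0::'a) 1. norm (T y) \<le> norm (T x)"
    by (rule continuous_attains_sup)
       (simp_all add: continuous_on_norm[OF linear_continuous_on[OF bl]])
  then obtain x where x: "norm x = 1" and max: "\<And>y. norm y = 1 \<Longrightarrow> norm (T y) \<le> norm (T x)"
    by auto
  have "?N \<le> norm (T x)"
  proof (rule onorm_bound)
    fix y
    show "norm (T y) \<le> norm (T x) * norm y"
    proof (cases "y = 0")
      case True then show ?thesis using linear_0[OF lin] by simp
    next
      case False
      have "norm (T (y /\<^sub>R norm y)) \<le> norm (T x)" using False by (intro max) simp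
      then show ?thesis using False by (simp add: linear_scale[OF lin] field_simps)
    qed
  qed simp
  then have N: "norm (T x) = ?N" using onorm[OF bl, of x] x by simp
  have N0: "?N \<ge> 0" using N by (metis norm_ge_zero)
  let ?w = "T (T x) - (?N^2) *\<^sub>R x"
  have "norm (T (T x)) \<le> ?N^2" using onorm[OF bl, of "T x"] N by (simp add: power2_eq_square)
  then have "(norm (T (T x)))^2 \<le> (?N^2)^2" by (intro power_mono) auto
  moreover have "T (T x) \<bullet> x = ?N^2" using sym[of "T x" x] N by (simp add: dot_square_norm)
  moreover have "x \<bullet> T (T x) = ?N^2" using calculation(2) by (simp add: inner_commute)
  moreover have "x \<bullet> x = 1" using x by (simp add: dot_square_norm)
  moreover have "(norm ?w)^2 = (norm (T (T x)))^2 - ?N^2 * (T (T x) \<bullet> x) - ?N^2 * (x \<bullet> T (T x))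
      + (?N^2)^2 * (x \<bullet> x)"
    unfolding dot_square_norm[symmetric]
    by (simp add: inner_diff_left inner_diff_right) (simp add: power2_eq_square power4_eq_xxxx algebra_simps)
  ultimately have "(norm ?w)^2 \<le> 0" by (simp add: power2_eq_square)
  then have TT: "T (T x) = (?N^2) *\<^sub>R x" by simp
  show ?thesis
  proof (cases "?N = 0")
    case True
    moreover have "x \<noteq> 0" using x by auto
    ultimately show ?thesis using that[of x] N by simp
  next
    case False
    \<comment> \<open>\<open>T - N\<close> kills \<open>(T + N) x\<close>, and this vector is
      nonzero because positivity of \<open>T\<close> makes its inner product with \<open>x\<close>
      at least \<open>N\<close>.\<close>
    define z where "z = T x + ?N *\<^sub>R x"
    have "T z = ?N *\<^sub>R z"
      by (simp add: z_def linear_add[OF lin] linear_scale[OF lin] TT power2_eq_square algebra_simps)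
    moreover have "z \<bullet> x > 0"
      using pos[of x] False N0 x by (simp add: z_def inner_add_left dot_square_norm add_nonneg_pos)
    then have "z \<noteq> 0" by auto
    ultimately show ?thesis using that by blast
  qed
qed

text \<open>The Euclidean structure of the complex space is the real one; through this identity
  Hermitian positive operators fall under the real eigenvector lemma.\<close>

lemma inner_complex_vec: "x \<bullet> y = Re (cip x y)"
  by (simp add: inner_vec_def cip_def inner_complex_def)

lemma cip_add_left: "cip (x + y) z = cip x z + cip y z"
  and cip_add_right: "cip x (y + z) = cip x y + cip x z"
  and cip_scale_left: "cip (c *s x) y = c * cip x y"
  and cip_scale_right: "cip x (c *s y) = cnj c * cip x y"
  by (simp_all add: cip_def algebra_simps sum.distrib sum_distrib_left)

lemma cip_cnj: "cip y x = cnj (cip x y)"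
  by (simp add: cip_def mult.commute)

lemma cip_sum_left: "cip (\<Sum>i\<in>A. g i) y = (\<Sum>i\<in>A. cip (g i) y)"
  by (induction A rule: infinite_finite_induct) (simp_all add: cip_add_left, simp_all add: cip_def)

lemma cip_self: "cip x x = complex_of_real ((norm x)^2)"
proof -
  have "Im (cip x x) = 0" by (simp add: cip_def)
  moreover have "Re (cip x x) = (norm x)^2" by (simp add: inner_complex_vec[symmetric] dot_square_norm)
  ultimately show ?thesis by (simp add: complex_eq_iff)
qed

text \<open>This is \<open>V^* D V\<close> as a sum of rank-one maps, with \<open>D\<close> the
  diagonal indicator of \<open>A\<close>.\<close>

definition partial_frame_op :: "('n \<Rightarrow> complex^'k) \<Rightarrow> 'n set \<Rightarrow> complex^'k \<Rightarrow> complex^'k" where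
  "partial_frame_op f A x = (\<Sum>i\<in>A. cip x (f i) *s f i)"

lemma sel_diag_mult_vec:
  fixes y :: "'a::comm_ring_1^'n::finite"
  shows "sel_diag A *v y = (\<chi> i. if i \<in> A then y $ i else 0)"
proof -
  have "(\<Sum>j\<in>UNIV. (if i = j \<and> i \<in> A then 1 else 0) * y $ j) = (if i \<in> A then y $ i else 0)" for i
  proof -
    have "(\<Sum>j\<in>UNIV. (if i = j \<and> i \<in> A then 1 else 0) * y $ j)
        = (\<Sum>j\<in>UNIV. if i = j then (if i \<in> A then y $ j else 0) else 0)"
      by (rule sum.cong) auto
    then show ?thesis by simp
  qed
  then show ?thesis by (simp add: vec_eq_iff matrix_vector_mult_def sel_diag_def)
qed

lemma analysis_sel_diag_eq_partial_frame_op: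
  fixes f :: "'n::finite \<Rightarrow> complex^'k::finite"
  shows "(cadj (analysis_c f) ** sel_diag A ** analysis_c f) *v x = partial_frame_op f A x"
proof -
  have V: "analysis_c f *v x = (\<chi> i. cip x (f i))"
    by (simp add: vec_eq_iff matrix_vector_mult_def analysis_c_def cip_def mult.commute)
  have S: "sel_diag A *v y = (\<chi> i. if i \<in> A then y $ i else 0)" for y :: "complex^'n"
    by (rule sel_diag_mult_vec)
  have "(cadj (analysis_c f) *v (sel_diag A *v (analysis_c f *v x))) $ j = partial_frame_op f A x $ j" for j
  proof -
    have "(cadj (analysis_c f) *v (sel_diag A *v (analysis_c f *v x))) $ j
        = (\<Sum>i\<in>UNIV. if i \<in> A then f i $ j * cip x (f i) else 0)"
      unfolding V S by (simp add: matrix_vector_mult_def cadj_def analysis_c_def)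
        (rule sum.cong, auto)
    also have "\<dots> = (\<Sum>i\<in>A. f i $ j * cip x (f i))"
      by (simp add: sum.If_cases)
    finally show ?thesis by (simp add: partial_frame_op_def mult.commute)
  qed
  then show ?thesis by (simp add: vec_eq_iff flip: matrix_vector_mul_assoc)
qed

definition block_norm :: "('n \<Rightarrow> complex^'k) \<Rightarrow> 'n set \<Rightarrow> real" where
  "block_norm f A = onorm (partial_frame_op f A)"

lemma uniform_c_iff_block_norm:
  "uniform_c m f \<longleftrightarrow> (\<forall>A B. card A = m \<longrightarrow> card B = m \<longrightarrow> block_norm f A = block_norm f B)"
  unfolding uniform_c_def block_norm_def analysis_sel_diag_eq_partial_frame_op ..

lemma linear_partial_frame_op:
  fixes f :: "'n \<Rightarrow> complex^'k::finite"
  shows "linear (partial_frame_op f A)"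
proof
  show "partial_frame_op f A (x + y) = partial_frame_op f A x + partial_frame_op f A y" for x y
    by (simp add: partial_frame_op_def cip_add_left sum.distrib vector_sadd_rdistrib)
  show "partial_frame_op f A (r *\<^sub>R x) = r *\<^sub>R partial_frame_op f A x" for r x
  proof -
    have "cip (r *\<^sub>R x) y = r *\<^sub>R cip x y" for y
      by (simp add: cip_def scaleR_sum_right)
    moreover have "(r *\<^sub>R c) *s v = r *\<^sub>R (c *s v)" for c and v :: "complex^'k"
      by (simp add: vec_eq_iff)
    ultimately show ?thesis by (simp add: partial_frame_op_def scaleR_sum_right)
  qed
qed

lemma cip_partial_frame_op:
  "cip (partial_frame_op f A x) y = (\<Sum>i\<in>A. cip x (f i) * cnj (cip y (f i)))"
  unfolding partial_frame_op_def cip_sum_left cip_scale_left cip_cnj[of "f _" y] ..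

lemma inner_partial_frame_op_self:
  "partial_frame_op f A x \<bullet> x = (\<Sum>i\<in>A. (cmod (cip x (f i)))^2)"
  unfolding inner_complex_vec cip_partial_frame_op
  by (simp add: complex_norm_square[symmetric] flip: of_real_power)

lemma block_norm_eigenvector:
  fixes f :: "'n \<Rightarrow> complex^'k::finite"
  obtains z where "z \<noteq> 0" "partial_frame_op f A z = block_norm f A *\<^sub>R z"
proof -
  have "partial_frame_op f A x \<bullet> y = x \<bullet> partial_frame_op f A y" for x y
  proof -
    have "cip (partial_frame_op f A x) y = cnj (cip (partial_frame_op f A y) x)"
      unfolding cip_partial_frame_op by (simp add: mult.commute)
    then have "partial_frame_op f A x \<bullet> y = partial_frame_op f A y \<bullet> x"
      by (simp add: inner_complex_vec)
    then show ?thesis by (simp add: inner_commute)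
  qed
  moreover have "partial_frame_op f A x \<bullet> x \<ge> 0" for x
    unfolding inner_partial_frame_op_self by (simp add: sum_nonneg)
  ultimately show ?thesis
    using onorm_positive_eigenvector[OF linear_partial_frame_op] that
    unfolding block_norm_def by blast
qed

text \<open>The Rayleigh bound: any test vector \<open>x\<close> bounds the norm from below.\<close>

lemma quadratic_form_le_block_norm:
  fixes f :: "'n \<Rightarrow> complex^'k::finite"
  shows "(\<Sum>i\<in>A. (cmod (cip x (f i)))^2) \<le> block_norm f A * (norm x)^2"
proof -
  have bl: "bounded_linear (partial_frame_op f A)"
    using linear_partial_frame_op by (rule linear_conv_bounded_linear[THEN iffD1])
  have "partial_frame_op f A x \<bullet> x \<le> norm (partial_frame_op f A x) * norm x"
    by (rule norm_cauchy_schwarz)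
  also have "\<dots> \<le> (block_norm f A * norm x) * norm x"
    unfolding block_norm_def by (intro mult_right_mono onorm[OF bl]) simp
  finally show ?thesis by (simp add: inner_partial_frame_op_self power2_eq_square mult.assoc)
qed

text \<open>The order of the arguments makes this the \<open>(i, j)\<close> entry of
  \<open>V V^*\<close>.\<close>

definition gram :: "('n \<Rightarrow> complex^'k) \<Rightarrow> 'n \<Rightarrow> 'n \<Rightarrow> complex" where
  "gram f i j = cip (f j) (f i)"

lemma gram_hermitian: "gram f j i = cnj (gram f i j)"
  unfolding gram_def by (rule cip_cnj)

lemma gram_diag: "gram f i i = complex_of_real ((norm (f i))^2)"
  unfolding gram_def by (rule cip_self)

text \<open>The test vector \<open>f i\<close> in the Rayleigh bound suffices; when it is zero the
  claim is that the norm is nonnegative.\<close>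

lemma norm_power2_le_block_norm:
  fixes f :: "'n \<Rightarrow> complex^'k::finite"
  assumes "finite A" "i \<in> A"
  shows "(norm (f i))^2 \<le> block_norm f A"
proof (cases "f i = 0")
  case True
  obtain z where z: "z \<noteq> 0" "partial_frame_op f A z = block_norm f A *\<^sub>R z"
    by (rule block_norm_eigenvector)
  then have "block_norm f A * (z \<bullet> z) = (\<Sum>i\<in>A. (cmod (cip z (f i)))^2)"
    by (simp flip: inner_partial_frame_op_self)
  then have "block_norm f A * (z \<bullet> z) \<ge> 0" by (simp add: sum_nonneg)
  then show ?thesis using z(1) True by (simp add: zero_le_mult_iff) (metis inner_gt_zero_iff not_less)
next
  case False
  have "((norm (f i))^2)^2 = (cmod (cip (f i) (f i)))^2" by (simp add: cip_self norm_power)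
  also have "\<dots> \<le> (\<Sum>j\<in>A. (cmod (cip (f i) (f j)))^2)"
    using assms by (intro member_le_sum) auto
  also have "\<dots> \<le> block_norm f A * (norm (f i))^2" by (rule quadratic_form_le_block_norm)
  finally show ?thesis using False by (simp add: power2_eq_square)
qed

text \<open>The coefficients \<open>cip z (f i)\<close> of an eigenvector \<open>z\<close> of
  \<open>V^* D V\<close> form an eigenvector of the Gram block. They cannot all vanish on
  \<open>A\<close>, since the operator would then kill \<open>z\<close>.\<close>

lemma block_norm_eigenvalue:
  fixes f :: "'n \<Rightarrow> complex^'k::finite"
  assumes "block_norm f A \<noteq> 0"
  obtains y where "\<exists>i\<in>A. y i \<noteq> 0"
    "\<And>i. (\<Sum>j\<in>A. gram f i j * y j) = complex_of_real (block_norm f A) * y i"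
proof -
  obtain z where z: "z \<noteq> 0" "partial_frame_op f A z = block_norm f A *\<^sub>R z"
    by (rule block_norm_eigenvector)
  define y where "y i = cip z (f i)" for i
  have "\<exists>i\<in>A. y i \<noteq> 0"
  proof (rule ccontr)
    assume "\<not> ?thesis"
    then have "partial_frame_op f A z = 0" by (simp add: partial_frame_op_def y_def)
    then show False using z assms by simp
  qed
  moreover have "(\<Sum>j\<in>A. gram f i j * y j) = complex_of_real (block_norm f A) * y i" for i
  proof -
    have "cip (partial_frame_op f A z) (f i) = (\<Sum>j\<in>A. gram f i j * y j)"
      unfolding cip_partial_frame_op gram_def y_def
      by (intro sum.cong refl) (simp add: cip_cnj[of _ "f i"] mult.commute)
    moreover have "cip (block_norm f A *\<^sub>R z) (f i) = complex_of_real (block_norm f A) * cip z (f i)"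
      unfolding cip_def vector_scaleR_component by (simp add: scaleR_sum_right flip: scaleR_conv_of_real)
    ultimately show ?thesis using z(2) by (simp add: y_def)
  qed
  ultimately show ?thesis using that by blast
qed

lemma block_norm_singleton:
  fixes f :: "'n \<Rightarrow> complex^'k::finite"
  shows "block_norm f {i} = (norm (f i))^2"
proof (cases "block_norm f {i} = 0")
  case True
  then show ?thesis using norm_power2_le_block_norm[of "{i}" i f] by simp
next
  case False
  then obtain y where y: "\<exists>m\<in>{i}. y m \<noteq> 0"
    "\<And>m. (\<Sum>j\<in>{i}. gram f m j * y j) = complex_of_real (block_norm f {i}) * y m"
    by (rule block_norm_eigenvalue) blast
  have "y i \<noteq> 0" using y(1) by simp
  then have "gram f i i = complex_of_real (block_norm f {i})" using y(2)[of i] by simp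
  then show ?thesis by (metis gram_diag of_real_eq_iff)
qed

text \<open>The 2 by 2 Gram block has eigenvalues \<open>a\<close> plus or minus
  \<open>cmod (gram f i j)\<close>; the lower bound \<open>a\<close> for the norm selects the plus
  sign.\<close>

lemma block_norm_pair:
  fixes f :: "'n \<Rightarrow> complex^'k::finite"
  assumes ne: "i \<noteq> j" and a: "(norm (f i))^2 = a" "(norm (f j))^2 = a" "a > 0"
  shows "block_norm f {i,j} = a + cmod (gram f i j)"
proof -
  let ?N = "block_norm f {i,j}" and ?z = "gram f i j"
  have N: "?N \<ge> a" using norm_power2_le_block_norm[of "{i,j}" i f] a by simp
  then have "?N \<noteq> 0" using a by simp
  then obtain y where y: "\<exists>m\<in>{i,j}. y m \<noteq> 0"
    "\<And>m. (\<Sum>l\<in>{i,j}. gram f m l * y l) = complex_of_real ?N * y m"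
    using block_norm_eigenvalue by blast
  define w where "w = cnj ?z"
  define L where "L = complex_of_real ?N - complex_of_real a"
  have "gram f j i = w" unfolding w_def by (rule gram_hermitian)
  then have e: "?z * y j = L * y i" "w * y i = L * y j"
    using y(2)[of i] y(2)[of j] ne by (simp_all add: gram_diag a L_def algebra_simps)
  have "(L^2 - ?z * w) * y i = 0" "(L^2 - ?z * w) * y j = 0"
    using e by algebra+
  then have "L^2 = ?z * w" using y(1) by auto
  then have "complex_of_real ((?N - a)^2) = complex_of_real ((cmod ?z)^2)"
    unfolding w_def by (simp add: L_def complex_norm_square[symmetric])
  then have "(?N - a)^2 = (cmod ?z)^2" by (simp only: of_real_eq_iff)
  from power2_eq_imp_eq[OF this] have "?N - a = cmod ?z" using N by simp
  then show ?thesis by simp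
qed

section \<open>Equiangular Parseval frames and their Seidel matrices\<close>

lemma matrix_inv_eqI:
  fixes M :: "'a::semiring_1^'n^'m"
  assumes "M ** N = mat 1" "N ** M = mat 1"
  shows "matrix_inv M = N"
proof -
  have "M ** matrix_inv M = mat 1 \<and> matrix_inv M ** M = mat 1"
    unfolding matrix_inv_def by (rule someI[of _ N]) (use assms in simp)
  then have "matrix_inv M = matrix_inv M ** (M ** N)" "matrix_inv M ** M ** N = N"
    using assms by simp_all
  then show ?thesis by (simp add: matrix_mul_assoc)
qed

lemma matrix_inv_permutation:
  fixes \<sigma> :: "'n::finite \<Rightarrow> 'm::finite"
  assumes "bij \<sigma>"
  shows "matrix_inv (\<chi> i j. if j = \<sigma> i then 1 else (0 :: 'a::semiring_1)) = (\<chi> j i. if j = \<sigma> i then 1 else 0)"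
proof (rule matrix_inv_eqI)
  have inj: "\<sigma> i = \<sigma> j \<longleftrightarrow> i = j" for i j using assms by (auto simp: bij_def inj_def)
  have inv: "j = \<sigma> i \<longleftrightarrow> i = inv \<sigma> j" for i j using assms by (metis bij_inv_eq_iff)
  show "(\<chi> i j. if j = \<sigma> i then 1 else (0 :: 'a)) ** (\<chi> j i. if j = \<sigma> i then 1 else 0) = mat 1"
    by (simp add: matrix_matrix_mult_def vec_eq_iff mat_def inj if_distrib[of "\<lambda>x. x * _"] cong: if_cong)
  show "(\<chi> j i. if j = \<sigma> i then 1 else (0 :: 'a)) ** (\<chi> i j. if j = \<sigma> i then 1 else 0) = mat 1"
    unfolding inv using bij_imp_bij_inv[OF assms]
    by (auto simp: matrix_matrix_mult_def vec_eq_iff mat_def bij_def inj_def if_distrib[of "\<lambda>x. x * _"] cong: if_cong)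
qed

lemma matrix_inv_unimodular_diag:
  fixes d :: "'n::finite \<Rightarrow> complex"
  assumes "\<And>i. cmod (d i) = 1"
  shows "matrix_inv (\<chi> i j. if i = j then d i else 0) = (\<chi> i j. if i = j then cnj (d i) else 0)"
proof (rule matrix_inv_eqI)
  have d: "d i * cnj (d i) = 1" "cnj (d i) * d i = 1" for i
    using unimodular_mult_cnj[OF assms] by (simp_all add: mult.commute)
  show "(\<chi> i j. if i = j then d i else 0) ** (\<chi> i j. if i = j then cnj (d i) else 0) = mat 1"
    by (simp add: matrix_matrix_mult_def vec_eq_iff mat_def d if_distrib[of "\<lambda>x. x * _"] cong: if_cong)
  show "(\<chi> i j. if i = j then cnj (d i) else 0) ** (\<chi> i j. if i = j then d i else 0) = mat 1"
    by (simp add: matrix_matrix_mult_def vec_eq_iff mat_def d if_distrib[of "\<lambda>x. x * _"] cong: if_cong)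
qed

text \<open>The inverse of \<open>P\<close> is its transpose and that of \<open>D\<close> its
  conjugate, so the matrix product collapses to one term per entry. The diagonal \<open>d\<close> is
  indexed by the index type of \<open>S\<close>, hence is evaluated at
  \<open>\<sigma> i\<close>.\<close>

lemma switching_equiv_iff:
  fixes Q :: "complex^'n::finite^'n" and S :: "complex^'m::finite^'m"
  shows "switching_equiv Q S \<longleftrightarrow>
    (\<exists>\<sigma> d. bij \<sigma> \<and> (\<forall>i. cmod (d i) = 1) \<and>
       (\<forall>i j. Q $ i $ j = d (\<sigma> i) * S $ \<sigma> i $ \<sigma> j * cnj (d (\<sigma> j))))"
proof -
  have eq: "((\<chi> i j. if j = \<sigma> i then 1 else 0) ** (\<chi> i j. if i = j then d i else 0) ** S
        ** matrix_inv (\<chi> i j. if i = j then d i else 0)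
        ** matrix_inv (\<chi> i j. if j = \<sigma> i then 1 else 0)) $ i $ j
      = d (\<sigma> i) * S $ \<sigma> i $ \<sigma> j * cnj (d (\<sigma> j))"
    if "bij \<sigma>" "\<forall>i. cmod (d i) = 1" for \<sigma> :: "'n \<Rightarrow> 'm" and d i j
    unfolding matrix_inv_permutation[OF that(1)] matrix_inv_unimodular_diag[OF that(2)[rule_format]]
    by (simp add: matrix_matrix_mult_def if_distrib[of "\<lambda>x. x * _"] if_distrib[of "\<lambda>x. _ * x"] cong: if_cong)
  show ?thesis
  proof
    assume "switching_equiv Q S"
    then obtain \<sigma> :: "'n \<Rightarrow> 'm" and d where *: "bij \<sigma>" "\<forall>i. cmod (d i) = 1"
      "Q = (\<chi> i j. if j = \<sigma> i then 1 else 0) ** (\<chi> i j. if i = j then d i else 0) ** S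
        ** matrix_inv (\<chi> i j. if i = j then d i else 0)
        ** matrix_inv (\<chi> i j. if j = \<sigma> i then 1 else 0)"
      unfolding switching_equiv_def by blast
    show "\<exists>\<sigma> d. bij \<sigma> \<and> (\<forall>i. cmod (d i) = 1) \<and>
       (\<forall>i j. Q $ i $ j = d (\<sigma> i) * S $ \<sigma> i $ \<sigma> j * cnj (d (\<sigma> j)))"
      by (intro exI[of _ \<sigma>] exI[of _ d] conjI allI *(1,2)) (simp only: *(3) eq[OF *(1,2)] *(2))+
  next
    assume "\<exists>\<sigma> d. bij \<sigma> \<and> (\<forall>i. cmod (d i) = 1) \<and>
       (\<forall>i j. Q $ i $ j = d (\<sigma> i) * S $ \<sigma> i $ \<sigma> j * cnj (d (\<sigma> j)))"
    then obtain \<sigma> d where *: "bij \<sigma>" "\<forall>i. cmod (d i) = 1"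
      "\<And>i j. Q $ i $ j = d (\<sigma> i) * S $ \<sigma> i $ \<sigma> j * cnj (d (\<sigma> j))" by blast
    have "Q = (\<chi> i j. if j = \<sigma> i then 1 else 0) ** (\<chi> i j. if i = j then d i else 0) ** S
        ** matrix_inv (\<chi> i j. if i = j then d i else 0)
        ** matrix_inv (\<chi> i j. if j = \<sigma> i then 1 else 0)"
      unfolding vec_eq_iff by (intro allI) (simp only: *(3) eq[OF *(1,2)])
    with *(1,2) show "switching_equiv Q S"
      unfolding switching_equiv_def by blast
  qed
qed

section \<open>Consequences of the Parseval identity\<close>

lemma parseval_c_polarization:
  fixes f :: "'n::finite \<Rightarrow> complex^'k::finite"
  assumes "parseval_c f"
  shows "(\<Sum>i\<in>UNIV. cip x (f i) * cnj (cip y (f i))) = cip x y"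
proof -
  \<comment> \<open>\<open>B\<close> is the sesquilinear defect, zero on the diagonal. The vectors
    \<open>x + y\<close> and \<open>x + \<i> *s y\<close> show that it is both antisymmetric and
    symmetric at \<open>x\<close>, \<open>y\<close>.\<close>
  define B where "B x y = (\<Sum>i\<in>UNIV. cip x (f i) * cnj (cip y (f i))) - cip x y" for x y
  have B0: "B v v = 0" for v
    using assms
    by (simp add: B_def parseval_c_def cip_self complex_norm_square[symmetric] flip: of_real_power of_real_sum)
  have Badd: "B (u + v) w = B u w + B v w" "B w (u + v) = B w u + B w v" for u v w
    by (simp_all add: B_def cip_add_left cip_add_right algebra_simps sum.distrib)
  have Bsc: "B (c *s u) w = c * B u w" "B w (c *s u) = cnj c * B w u" for c u w
    by (simp_all add: B_def cip_scale_left cip_scale_right algebra_simps sum_distrib_left)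
  have "B x y + B y x = 0"
    using B0[of "x + y", unfolded Badd] by (simp add: B0 add.commute)
  moreover have "- \<i> * B x y + \<i> * B y x = 0"
    using B0[of "x + \<i> *s y", unfolded Badd Bsc] by (simp add: B0 add.commute)
  then have "B x y = B y x" by simp
  ultimately have "B x y = 0" by simp
  then show ?thesis by (simp add: B_def)
qed

text \<open>\<open>V^* V = I\<close> makes \<open>V V^*\<close> a projection: this is polarization
  at \<open>f j\<close> and \<open>f i\<close>.\<close>

lemma gram_idempotent:
  fixes f :: "'n::finite \<Rightarrow> complex^'k::finite"
  assumes "parseval_c f"
  shows "(\<Sum>l\<in>UNIV. gram f i l * gram f l j) = gram f i j"
proof -
  have "gram f i l * gram f l j = cip (f j) (f l) * cnj (cip (f i) (f l))" for l
    unfolding gram_def cip_cnj[of "f l" "f i"] by (rule mult.commute)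
  then have "(\<Sum>l\<in>UNIV. gram f i l * gram f l j) = (\<Sum>l\<in>UNIV. cip (f j) (f l) * cnj (cip (f i) (f l)))"
    by (intro sum.cong refl)
  then show ?thesis unfolding parseval_c_polarization[OF assms] gram_def .
qed

text \<open>The trace of \<open>V V^*\<close>: the Parseval identity is summed over the coordinate
  vectors and the sums are swapped.\<close>

lemma parseval_c_sum_norm:
  fixes f :: "'n::finite \<Rightarrow> complex^'k::finite"
  assumes "parseval_c f"
  shows "(\<Sum>i\<in>UNIV. (norm (f i))^2) = real CARD('k)"
proof -
  have cip_axis: "cip (axis j 1) v = cnj (v $ j)" for j and v :: "complex^'k"
    by (simp add: cip_def axis_def if_distrib[of "\<lambda>x. x * _"] cong: if_cong)
  have "complex_of_real ((norm (axis j 1 :: complex^'k))^2) = 1" for j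
    unfolding cip_self[symmetric] cip_axis by (simp add: axis_def)
  then have norm_axis: "(norm (axis j 1 :: complex^'k))^2 = 1" for j
    by (metis of_real_eq_1_iff)
  have "(\<Sum>i\<in>UNIV. (norm (f i))^2) = (\<Sum>i\<in>UNIV. \<Sum>j\<in>UNIV. (cmod (cip (axis j 1) (f i)))^2)"
    by (simp add: cip_axis norm_vec_def L2_set_def sum_nonneg)
  also have "\<dots> = (\<Sum>j\<in>UNIV. \<Sum>i\<in>UNIV. (cmod (cip (axis j 1) (f i)))^2)" by (rule sum.swap)
  also have "\<dots> = (\<Sum>j\<in>(UNIV::'k set). 1)"
    using assms by (simp add: parseval_c_def norm_axis)
  finally show ?thesis by simp
qed

lemma seidel_c_nth:
  fixes f :: "'n::finite \<Rightarrow> complex^'k::finite"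
  shows "seidel_c f $ i $ j =
    (gram f i j - (if i = j then complex_of_real (real CARD('k) / real CARD('n)) else 0))
      / complex_of_real (c_nk CARD('n) CARD('k))"
  by (simp add: seidel_c_def matrix_matrix_mult_def analysis_c_def cadj_def gram_def cip_def mult.commute)

text \<open>Singleton blocks have norm \<open>(norm (f i))^2\<close>; the trace fixes the common
  value.\<close>

lemma uniform_1_iff:
  fixes f :: "'n::finite \<Rightarrow> complex^'k::finite"
  assumes "parseval_c f"
  shows "uniform_c 1 f \<longleftrightarrow> (\<forall>i. (norm (f i))^2 = real CARD('k) / real CARD('n))"
proof
  assume u: "uniform_c 1 f"
  show "\<forall>i. (norm (f i))^2 = real CARD('k) / real CARD('n)"
  proof
    fix i
    have "(norm (f j))^2 = (norm (f i))^2" for j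
      using u[unfolded uniform_c_iff_block_norm, rule_format, of "{j}" "{i}"]
      by (simp add: block_norm_singleton)
    then have "(\<Sum>j\<in>UNIV. (norm (f j))^2) = (\<Sum>j\<in>(UNIV::'n set). (norm (f i))^2)"
      by (intro sum.cong refl)
    then show "(norm (f i))^2 = real CARD('k) / real CARD('n)"
      using parseval_c_sum_norm[OF assms] by (simp add: field_simps)
  qed
next
  assume "\<forall>i. (norm (f i))^2 = real CARD('k) / real CARD('n)"
  then show "uniform_c 1 f"
    unfolding uniform_c_iff_block_norm by (auto simp: card_1_singleton_iff block_norm_singleton)
qed

text \<open>Pairs have norm \<open>a + cmod (gram f i j)\<close> with \<open>a = k/n\<close>, so
  equal norms mean equal moduli \<open>c\<close>; a diagonal entry of \<open>G^2 = G\<close> reads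
  \<open>a = a^2 + (n - 1) c^2\<close> and determines \<open>c\<close>.\<close>

lemma uniform_2_iff:
  fixes f :: "'n::finite \<Rightarrow> complex^'k::finite"
  assumes pars: "parseval_c f" and norm: "\<And>i. (norm (f i))^2 = real CARD('k) / real CARD('n)"
    and n: "CARD('n) \<ge> 2"
  shows "uniform_c 2 f \<longleftrightarrow> (\<forall>i j. i \<noteq> j \<longrightarrow> cmod (gram f i j) = c_nk CARD('n) CARD('k))"
proof
  let ?a = "real CARD('k) / real CARD('n)"
  assume u: "uniform_c 2 f"
  show "\<forall>i j. i \<noteq> j \<longrightarrow> cmod (gram f i j) = c_nk CARD('n) CARD('k)"
  proof (intro allI impI)
    fix i j :: 'n assume ij: "i \<noteq> j"
    let ?c = "cmod (gram f i j)"
    have c: "cmod (gram f i l) = ?c" if "i \<noteq> l" for l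
      using u[unfolded uniform_c_iff_block_norm, rule_format, of "{i,l}" "{i,j}"] that ij
      by (simp add: block_norm_pair norm)
    have mod: "Re (gram f i l * gram f l i) = (cmod (gram f i l))^2" for l
      unfolding gram_hermitian[of f l i] cmod_power2 by (simp add: power2_eq_square)
    have "?a = Re (\<Sum>l\<in>UNIV. gram f i l * gram f l i)"
      unfolding gram_idempotent[OF pars] by (simp add: gram_diag norm)
    also have "\<dots> = (\<Sum>l\<in>UNIV. (cmod (gram f i l))^2)"
      unfolding Re_sum mod ..
    also have "\<dots> = (cmod (gram f i i))^2 + (\<Sum>l\<in>UNIV - {i}. (cmod (gram f i l))^2)"
      by (simp add: sum.remove[of UNIV i])
    also have "(\<Sum>l\<in>UNIV - {i}. (cmod (gram f i l))^2) = (\<Sum>l\<in>UNIV - {i}. ?c^2)"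
      by (rule sum.cong) (use c in auto)
    also have "\<dots> = (real CARD('n) - 1) * ?c^2" using n by (simp add: of_nat_diff)
    also have "(cmod (gram f i i))^2 = ?a^2" by (simp add: gram_diag norm norm_divide)
    finally have "?c^2 = (?a - ?a^2) / (real CARD('n) - 1)" using n by (simp add: field_simps)
    also have "\<dots> = real CARD('k) * (real CARD('n) - real CARD('k)) / ((real CARD('n))^2 * (real CARD('n) - 1))"
      using n by (simp add: field_simps power2_eq_square)
    finally show "?c = c_nk CARD('n) CARD('k)"
      unfolding c_nk_def by (metis norm_ge_zero real_sqrt_unique)
  qed
next
  assume "\<forall>i j. i \<noteq> j \<longrightarrow> cmod (gram f i j) = c_nk CARD('n) CARD('k)"
  then show "uniform_c 2 f"
    unfolding uniform_c_iff_block_norm by (auto simp: card_2_iff block_norm_pair norm)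
qed

section \<open>The Seidel matrix of an equiangular Parseval frame\<close>

lemma c_nk_pos: "0 < k \<Longrightarrow> k < n \<Longrightarrow> c_nk n k > 0"
  and c_nk_power2: "0 < k \<Longrightarrow> k < n \<Longrightarrow>
    (c_nk n k)^2 = real k * (real n - real k) / ((real n)^2 * (real n - 1))"
proof -
  assume k: "0 < k" "k < n"
  then have pos: "real k * (real n - real k) / ((real n)^2 * (real n - 1)) > 0"
    by (intro divide_pos_pos mult_pos_pos) auto
  then show "c_nk n k > 0" unfolding c_nk_def by simp
  show "(c_nk n k)^2 = real k * (real n - real k) / ((real n)^2 * (real n - 1))"
    unfolding c_nk_def using pos by (intro real_sqrt_pow2) simp
qed

text \<open>With \<open>a = k/n\<close> and \<open>c = c_nk n k\<close>, the scalar \<open>(1 - 2a) / c\<close> is the \<open>\<mu>\<close> in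
  \<open>Q\<^sup>2 = (n - 1) I + \<mu> Q\<close>, obtained by expanding \<open>(aI + cQ)\<^sup>2 = aI + cQ\<close>.\<close>

lemma seidel_scalar_nontrivial:
  assumes k: "0 < k" "k < n" "k \<noteq> 1" "k \<noteq> n - 1"
  shows "((1 - 2 * (real k / real n)) / c_nk n k)^2 \<noteq> (real n - 2)^2"
proof
  let ?n = "real n" and ?k = "real k"
  assume "((1 - 2 * (?k / ?n)) / c_nk n k)^2 = (?n - 2)^2"
  then have "(1 - 2 * (?k / ?n))^2 = (?n - 2)^2 * (c_nk n k)^2"
    using c_nk_pos[OF k(1,2)] by (simp add: power_divide field_simps)
  then have "(1 - 2 * (?k / ?n))^2 = (?n - 2)^2 * (?k * (?n - ?k) / (?n^2 * (?n - 1)))"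
    unfolding c_nk_power2[OF k(1,2)] .
  moreover have n0: "?n > 1" using k by simp
  then have "1 - 2 * (?k / ?n) = (?n - 2 * ?k) / ?n" by (simp add: field_simps)
  ultimately have "(?n - 2 * ?k)^2 / ?n^2 = (?n - 2)^2 * (?k * (?n - ?k)) / (?n^2 * (?n - 1))"
    by (simp add: power_divide)
  then have "(?n - 2 * ?k)^2 * (?n - 1) = (?n - 2)^2 * (?k * (?n - ?k))"
    using n0 by (simp add: divide_simps)
  \<comment> \<open>The left side minus the right side of the previous equation is
    \<open>- n^2 (k - 1) (n - 1 - k)\<close>, so equality occurs exactly for trivial frames.\<close>
  then have "?n^2 * ((?k - 1) * (?n - 1 - ?k)) = 0" by algebra
  then have "?k = 1 \<or> ?n - 1 = ?k" using n0 by auto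
  then show False using k by (auto simp: of_nat_diff)
qed

lemma seidel_like_seidel_c:
  fixes f :: "'n::finite \<Rightarrow> complex^'k::finite"
  assumes k: "CARD('k) < CARD('n)"
    and norm: "\<And>i. (norm (f i))^2 = real CARD('k) / real CARD('n)"
    and ang: "\<And>i j. i \<noteq> j \<Longrightarrow> cmod (gram f i j) = c_nk CARD('n) CARD('k)"
  shows "seidel_like (\<lambda>i j. seidel_c f $ i $ j)"
  unfolding seidel_like_def
proof (intro conjI allI impI)
  have c: "c_nk CARD('n) CARD('k) > 0" using k by (intro c_nk_pos) simp_all
  show "seidel_c f $ i $ i = 0" for i
    by (simp add: seidel_c_nth gram_diag norm)
  show "cmod (seidel_c f $ i $ j) = 1" if "i \<noteq> j" for i j
    using c that by (simp add: seidel_c_nth norm_divide ang)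
  show "seidel_c f $ j $ i = cnj (seidel_c f $ i $ j)" for i j
    using gram_hermitian[of f j i] by (simp add: seidel_c_nth)
qed

text \<open>An off-diagonal entry of \<open>Q^2 = (n - 1) I + \<mu> Q\<close>, where the identity
  term drops out.\<close>

lemma seidel_c_square:
  fixes f :: "'n::finite \<Rightarrow> complex^'k::finite"
  assumes pars: "parseval_c f" and ij: "i \<noteq> j"
  shows "(\<Sum>l\<in>UNIV. seidel_c f $ i $ l * seidel_c f $ l $ j) =
    complex_of_real ((1 - 2 * (real CARD('k) / real CARD('n))) / c_nk CARD('n) CARD('k)) * seidel_c f $ i $ j"
proof -
  define a where "a = complex_of_real (real CARD('k) / real CARD('n))"
  define c where "c = complex_of_real (c_nk CARD('n) CARD('k))"
  define g where "g = gram f"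
  have Q: "seidel_c f $ i $ j = (g i j - (if i = j then a else 0)) / c" for i j
    by (simp add: seidel_c_nth a_def c_def g_def)
  have "(\<Sum>l\<in>UNIV. (g i l - (if i = l then a else 0)) * (g l j - (if l = j then a else 0)))
      = (\<Sum>l\<in>UNIV. g i l * g l j - (if i = l then a * g l j else 0) - (if l = j then g i l * a else 0))"
    by (rule sum.cong) (use ij in \<open>auto simp: algebra_simps\<close>)
  also have "\<dots> = g i j - a * g i j - g i j * a"
    unfolding sum_subtractf g_def gram_idempotent[OF pars] by simp
  finally have *: "(\<Sum>l\<in>UNIV. (g i l - (if i = l then a else 0)) * (g l j - (if l = j then a else 0)))
      = (1 - 2 * a) * g i j" by (simp add: algebra_simps)
  have "(\<Sum>l\<in>UNIV. seidel_c f $ i $ l * seidel_c f $ l $ j) = (1 - 2 * a) * g i j / (c * c)"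
    unfolding *[symmetric] Q by (simp add: sum_divide_distrib)
  also have "\<dots> = ((1 - 2 * a) / c) * seidel_c f $ i $ j" using ij by (simp add: Q)
  finally show ?thesis by (simp add: a_def c_def)
qed

text \<open>\<open>Q = (G - a I) / c\<close> shifts and rescales the eigenvalue of the Gram block in
  the same way for every \<open>A\<close>, so blocks of equal norm share this eigenvalue.\<close>

lemma seidel_c_block_eigenvalue:
  fixes f :: "'n::finite \<Rightarrow> complex^'k::finite"
  assumes norm: "\<And>i. (norm (f i))^2 = real CARD('k) / real CARD('n)"
    and A: "A \<noteq> {}"
  shows "block_eigenvalue (\<lambda>i j. seidel_c f $ i $ j) A
    ((block_norm f A - real CARD('k) / real CARD('n)) / c_nk CARD('n) CARD('k))"
proof -
  define a where "a = complex_of_real (real CARD('k) / real CARD('n))"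
  define c where "c = complex_of_real (c_nk CARD('n) CARD('k))"
  obtain i where "i \<in> A" using A by blast
  then have "block_norm f A \<ge> real CARD('k) / real CARD('n)"
    using norm_power2_le_block_norm[of A i f] by (simp add: norm)
  then have "block_norm f A \<noteq> 0" by (smt (verit) divide_pos_pos of_nat_0_less_iff zero_less_card_finite)
  then obtain y where y: "\<exists>i\<in>A. y i \<noteq> 0"
    "\<And>i. (\<Sum>j\<in>A. gram f i j * y j) = complex_of_real (block_norm f A) * y i"
    using block_norm_eigenvalue by blast
  have "(\<Sum>j\<in>A. seidel_c f $ i $ j * y j) = ((complex_of_real (block_norm f A) - a) / c) * y i"
    if "i \<in> A" for i
  proof -
    have "(\<Sum>j\<in>A. seidel_c f $ i $ j * y j) = (\<Sum>j\<in>A. (gram f i j * y j - (if i = j then a * y j else 0)) / c)"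
      by (rule sum.cong) (auto simp: seidel_c_nth a_def c_def algebra_simps)
    also have "\<dots> = ((\<Sum>j\<in>A. gram f i j * y j) - a * y i) / c"
      using that by (simp add: sum_subtractf flip: sum_divide_distrib)
    finally show ?thesis unfolding y(2) by (simp add: algebra_simps)
  qed
  then show ?thesis
    unfolding block_eigenvalue_def using y(1) by (intro exI[of _ y]) (simp add: a_def c_def)
qed

section \<open>The given 4 by 4 matrix and the forward implication\<close>

lemma idx4_simps [simp]: "idx4 0 = 0" "idx4 1 = 1" "idx4 2 = 2" "idx4 3 = 3"
  by (simp_all add: idx4_def)

text \<open>In the type \<open>4\<close> the numeral 4 equals 0, and \<open>seidel4\<close> is
  indexed from 0.\<close>

lemma exhaust_4_zero: "(i::4) = 0 \<or> i = 1 \<or> i = 2 \<or> i = 3"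
  using exhaust_4[of i] by auto

lemma seidel4_diag: "seidel4 $ i $ i = 0"
  using exhaust_4_zero[of i] by (elim disjE) (simp_all add: seidel4_def)

lemma norm_seidel4: "i \<noteq> j \<Longrightarrow> cmod (seidel4 $ i $ j) = 1"
  using exhaust_4_zero[of i] exhaust_4_zero[of j] by (elim disjE) (simp_all add: seidel4_def)

lemma uniform_imp_switching_equiv:
  fixes f :: "'n::finite \<Rightarrow> complex^'k::finite"
  assumes pars: "parseval_c f" and k: "CARD('k) < CARD('n)" "CARD('k) \<noteq> 1" "CARD('k) \<noteq> CARD('n) - 1"
    and unif: "uniform_upto_c 4 f"
  shows "switching_equiv (seidel_c f) seidel4"
proof -
  have k0: "CARD('k) > 0" by simp
  \<comment> \<open>Nontriviality gives \<open>2 \<le> k\<close> and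
    \<open>k \<le> n - 2\<close>.\<close>
  have n4: "CARD('n) \<ge> 4" using k k0 by linarith
  have u: "uniform_c 1 f" "uniform_c 2 f" "uniform_c 3 f" "uniform_c 4 f"
    using unif by (auto simp: uniform_upto_c_def)
  have norm: "(norm (f i))^2 = real CARD('k) / real CARD('n)" for i
    using u(1) uniform_1_iff[OF pars] by blast
  have ang: "cmod (gram f i j) = c_nk CARD('n) CARD('k)" if "i \<noteq> j" for i j
    using u(2) uniform_2_iff[OF pars norm] n4 that by auto
  define Q where "Q i j = seidel_c f $ i $ j" for i j
  have Q: "seidel_like Q" unfolding Q_def by (rule seidel_like_seidel_c[OF k(1) norm ang])
  \<comment> \<open>The norm of any single set of size \<open>m\<close> yields the common
    eigenvalue; if no such set exists the claim is vacuous.\<close>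
  have ev: "\<exists>l. \<forall>A. card A = m \<longrightarrow> block_eigenvalue Q A l" if "uniform_c m f" "m > 0" for m
  proof (cases "\<exists>B::'n set. card B = m")
    case True
    then obtain B :: "'n set" where B: "card B = m" by blast
    have "block_eigenvalue Q A ((block_norm f B - real CARD('k) / real CARD('n)) / c_nk CARD('n) CARD('k))"
      if A: "card A = m" for A
    proof -
      have eq: "block_norm f A = block_norm f B"
        using \<open>uniform_c m f\<close> A B unfolding uniform_c_iff_block_norm by blast
      have "A \<noteq> {}" using A \<open>m > 0\<close> by force
      from seidel_c_block_eigenvalue[of f, OF norm this] show ?thesis unfolding eq Q_def .
    qed
    then show ?thesis by blast
  qed blast
  obtain l3 where l3: "\<And>A. card A = 3 \<Longrightarrow> block_eigenvalue Q A l3" using ev[OF u(3)] by auto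
  obtain l4 where l4: "\<And>A. card A = 4 \<Longrightarrow> block_eigenvalue Q A l4" using ev[OF u(4)] by auto
  obtain p :: 'n where True by blast
  \<comment> \<open>Multiplying by \<open>cnj (Q p j)\<close> on the right turns row
    \<open>p\<close> into ones; the value 1 at \<open>p\<close> replaces the diagonal zero, so that
    \<open>d\<close> is unimodular.\<close>
  define d where "d i = (if i = p then 1 else Q p i)" for i
  define R where "R i j = d i * Q i j * cnj (d j)" for i j
  have h: "Q j i = cnj (Q i j)" and diag: "Q i i = 0" for i j
    using Q unfolding seidel_like_def by blast+
  have mod1: "cmod (Q i j) = 1" if "i \<noteq> j" for i j
    using Q that unfolding seidel_like_def by blast
  have d: "cmod (d i) = 1" for i using mod1 by (simp add: d_def)
  have dd: "d i * cnj (d i) = 1" "cnj (d i) * d i = 1" for i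
    using unimodular_mult_cnj[OF d] by (simp_all add: mult.commute)
  have R: "seidel_like R"
    unfolding seidel_like_def
  proof (intro conjI allI impI)
    show "R i i = 0" for i by (simp add: R_def diag)
    show "cmod (R i j) = 1" if "i \<noteq> j" for i j by (simp add: R_def norm_mult d mod1 that)
    show "R j i = cnj (R i j)" for i j
      unfolding R_def h[of j i] by simp
  qed
  have one: "R p j = 1" if "j \<noteq> p" for j
    using dd(1)[of j] that by (simp add: R_def d_def)
  let ?\<mu> = "(1 - 2 * (real CARD('k) / real CARD('n))) / c_nk CARD('n) CARD('k)"
  have sq: "(\<Sum>j\<in>UNIV. R a j * R j p) = complex_of_real ?\<mu> * R a p" if "a \<noteq> p" for a
  proof -
    have "R a j * R j p = d a * cnj (d p) * (Q a j * Q j p)" for j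
    proof -
      have "R a j * R j p = d a * cnj (d p) * (Q a j * Q j p) * (cnj (d j) * d j)"
        unfolding R_def by (simp only: mult_ac)
      then show ?thesis by (simp add: dd)
    qed
    then have "(\<Sum>j\<in>UNIV. R a j * R j p) = d a * cnj (d p) * (\<Sum>j\<in>UNIV. Q a j * Q j p)"
      by (simp add: sum_distrib_left)
    also have "(\<Sum>j\<in>UNIV. Q a j * Q j p) = complex_of_real ?\<mu> * Q a p"
      unfolding Q_def by (rule seidel_c_square[OF pars that])
    finally show ?thesis unfolding R_def by (simp only: mult_ac)
  qed
  have evR: "block_eigenvalue R A l" if "block_eigenvalue Q A l" for A l
    unfolding R_def by (rule block_eigenvalue_switch[OF d that])
  from normalized_seidel_like_card_4[OF R one sq evR[OF l3] evR[OF l4] n4 seidel_scalar_nontrivial[OF k0 k]]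
  obtain a b c where abc: "distinct [p,a,b,c]" "UNIV = {p,a,b,c}"
    "R a b = \<i>" "R b c = \<i>" "R c a = \<i>" by blast
  have hR: "R j i = cnj (R i j)" and diagR: "R i i = 0" for i j
    using R unfolding seidel_like_def by blast+
  \<comment> \<open>The cycle runs through \<open>a\<close>, \<open>b\<close>, \<open>c\<close> with
    entries \<open>\<i>\<close>, whereas \<open>seidel4\<close> has \<open>- \<i>\<close> from 1 to
    2; hence \<open>c\<close> goes to 2 and \<open>b\<close> to 3.\<close>
  define \<sigma> :: "'n \<Rightarrow> 4" where "\<sigma> i = (if i = p then 0 else if i = a then 1 else if i = c then 2 else 3)" for i
  have \<sigma>: "\<sigma> p = 0" "\<sigma> a = 1" "\<sigma> c = 2" "\<sigma> b = 3" using abc(1) by (auto simp: \<sigma>_def)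
  have cases: "i = p \<or> i = a \<or> i = b \<or> i = c" for i using abc(2) by blast
  have bij: "bij \<sigma>"
  proof (rule bijI)
    show "inj \<sigma>"
    proof (rule injI)
      fix x y assume "\<sigma> x = \<sigma> y"
      then show "x = y" using cases[of x] cases[of y] by (auto simp: \<sigma>)
    qed
    show "surj \<sigma>"
      unfolding surj_def using exhaust_4_zero \<sigma> by metis
  qed
  have RS: "R i j = seidel4 $ \<sigma> i $ \<sigma> j" for i j
  proof -
    have row: "R p a = 1" "R p b = 1" "R p c = 1" using abc(1) by (auto intro: one)
    have col: "R a p = 1" "R b p = 1" "R c p = 1" "R b a = -\<i>" "R c b = -\<i>" "R a c = -\<i>"
      by (subst hR, simp add: row abc(3-5))+
    show ?thesis
      using cases[of i] cases[of j]
      by (elim disjE) (simp_all add: \<sigma> seidel4_def diagR row col abc(3-5))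
  qed
  show ?thesis
    unfolding switching_equiv_iff
  \<comment> \<open>Undoing the switch conjugates \<open>d\<close>, and \<open>inv \<sigma>\<close>
    transports it to the index type \<open>4\<close>.\<close>
  proof (intro exI[of _ \<sigma>] exI[of _ "\<lambda>m. cnj (d (inv \<sigma> m))"] conjI allI bij)
    show "cmod (cnj (d (inv \<sigma> m))) = 1" for m by (simp add: d)
    fix i j
    have "cnj (d i) * R i j * d j = Q i j * (cnj (d i) * d i) * (cnj (d j) * d j)"
      unfolding R_def by (simp only: mult_ac)
    then have "Q i j = cnj (d i) * R i j * d j" by (simp add: dd)
    then show "seidel_c f $ i $ j = cnj (d (inv \<sigma> (\<sigma> i))) * seidel4 $ \<sigma> i $ \<sigma> j * cnj (cnj (d (inv \<sigma> (\<sigma> j))))"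
      using bij by (simp add: Q_def RS bij_is_inj inv_f_f)
  qed
qed

section \<open>The converse implication\<close>

lemma exists_orthogonal_complex_vec:
  fixes v :: "complex^'k::finite"
  assumes "CARD('k) \<ge> 2"
  obtains x where "x \<noteq> 0" "cip x v = 0"
proof -
  obtain p q :: 'k where pq: "p \<noteq> q"
    using assms by (metis (full_types) card_2_iff' ex_card)
  have cip_axis: "cip (axis j c) w = c * cnj (w $ j)" for j c and w :: "complex^'k"
    by (simp add: cip_def axis_def if_distrib[of "\<lambda>x. x * _"] cong: if_cong)
  show ?thesis
  proof (cases "v $ p = 0")
    case True
    then show ?thesis using that[of "axis p 1"] by (simp add: cip_axis axis_eq_0_iff)
  next
    case False
    \<comment> \<open>The two coordinates are chosen so that their contributions to
      \<open>cip ?x v\<close> cancel.\<close>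
    let ?x = "axis p (- cnj (v $ q)) + axis q (cnj (v $ p))"
    have "?x $ q = cnj (v $ p)" using pq by (simp add: axis_def)
    then have "?x \<noteq> 0" using False by (metis complex_cnj_zero_iff zero_index)
    moreover have "cip ?x v = 0" by (simp add: cip_add_left cip_axis)
    ultimately show ?thesis using that by blast
  qed
qed

text \<open>The Parseval identity bounds the norm by 1, and a nonzero vector orthogonal to
  \<open>f i\<close> attains the bound because the omitted term is zero.\<close>

lemma block_norm_Compl_singleton:
  fixes f :: "'n::finite \<Rightarrow> complex^'k::finite"
  assumes pars: "parseval_c f" and k: "CARD('k) \<ge> 2"
  shows "block_norm f (UNIV - {i}) = 1"
proof (rule antisym)
  obtain z where z: "z \<noteq> 0" "partial_frame_op f (UNIV - {i}) z = block_norm f (UNIV - {i}) *\<^sub>R z"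
    by (rule block_norm_eigenvector)
  have "block_norm f (UNIV - {i}) * (norm z)^2 = (\<Sum>j\<in>UNIV - {i}. (cmod (cip z (f j)))^2)"
    using z(2) by (simp add: dot_square_norm flip: inner_partial_frame_op_self)
  also have "\<dots> \<le> (\<Sum>j\<in>UNIV. (cmod (cip z (f j)))^2)" by (rule sum_mono2) auto
  also have "\<dots> = (norm z)^2" using pars by (simp add: parseval_c_def)
  finally show "block_norm f (UNIV - {i}) \<le> 1" using z(1) by simp
  obtain x where x: "x \<noteq> 0" "cip x (f i) = 0" by (rule exists_orthogonal_complex_vec[OF k])
  have "(norm x)^2 = (\<Sum>j\<in>UNIV. (cmod (cip x (f j)))^2)" using pars by (simp add: parseval_c_def)
  also have "\<dots> = (\<Sum>j\<in>UNIV - {i}. (cmod (cip x (f j)))^2)"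
    by (rule sum.mono_neutral_right) (use x(2) in auto)
  also have "\<dots> \<le> block_norm f (UNIV - {i}) * (norm x)^2" by (rule quadratic_form_le_block_norm)
  finally show "1 \<le> block_norm f (UNIV - {i})" using x(1) by simp
qed

text \<open>The bijection forces \<open>n = 4\<close>. The zero diagonal gives equal norms and the
  unimodular entries give equal angles; sets of size 3 are complements of points, and only one set
  has size 4.\<close>

lemma switching_equiv_imp_uniform:
  fixes f :: "'n::finite \<Rightarrow> complex^'k::finite"
  assumes pars: "parseval_c f" and k: "CARD('k) < CARD('n)" "CARD('k) \<noteq> 1"
    and sw: "switching_equiv (seidel_c f) seidel4"
  shows "uniform_upto_c 4 f"
proof -
  obtain \<sigma> :: "'n \<Rightarrow> 4" and d where sd: "bij \<sigma>" "\<And>i. cmod (d i) = 1"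
    "\<And>i j. seidel_c f $ i $ j = d (\<sigma> i) * seidel4 $ \<sigma> i $ \<sigma> j * cnj (d (\<sigma> j))"
    using sw unfolding switching_equiv_iff by blast
  have n: "CARD('n) = 4" using bij_betw_same_card[OF sd(1)] by simp
  have k0: "CARD('k) > 0" by simp
  have k2: "CARD('k) \<ge> 2" using k(2) k0 by linarith
  have c: "c_nk CARD('n) CARD('k) > 0" by (rule c_nk_pos[OF k0 k(1)])
  have norm: "(norm (f i))^2 = real CARD('k) / real CARD('n)" for i
  proof -
    have "seidel_c f $ i $ i = 0" by (simp add: sd(3) seidel4_diag)
    then have "complex_of_real ((norm (f i))^2) = complex_of_real (real CARD('k) / real CARD('n))"
      using c unfolding seidel_c_nth gram_diag by simp
    then show ?thesis by (simp only: of_real_eq_iff)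
  qed
  have ang: "cmod (gram f i j) = c_nk CARD('n) CARD('k)" if "i \<noteq> j" for i j
  proof -
    have "\<sigma> i \<noteq> \<sigma> j" using sd(1) that by (metis bij_def injD)
    then have "cmod (seidel_c f $ i $ j) = 1" by (simp add: sd norm_seidel4 norm_mult)
    then show ?thesis using c that by (simp add: seidel_c_nth norm_divide)
  qed
  have "uniform_c 1 f" using uniform_1_iff[OF pars] norm by blast
  moreover have "uniform_c 2 f" using uniform_2_iff[OF pars norm] ang n by simp
  moreover have "uniform_c 3 f"
  proof -
    have "block_norm f A = 1" if "card A = 3" for A :: "'n set"
    proof -
      have "card (UNIV - A) = 1" using that n by (simp add: card_Diff_subset)
      then obtain i where "UNIV - A = {i}" by (auto simp: card_1_singleton_iff)
      then have "A = UNIV - {i}" by blast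
      then show ?thesis using block_norm_Compl_singleton[OF pars k2] by simp
    qed
    then show ?thesis unfolding uniform_c_iff_block_norm by simp
  qed
  moreover have "uniform_c 4 f"
  proof -
    have "A = UNIV" if "card A = 4" for A :: "'n set"
      using that n by (intro card_subset_eq) simp_all
    then show ?thesis unfolding uniform_c_iff_block_norm by metis
  qed
  moreover have "{1..4} = {1, 2, 3, 4::nat}" by auto
  ultimately show ?thesis unfolding uniform_upto_c_def by simp
qed

section \<open>Real frames\<close>

definition complexify :: "real^'k \<Rightarrow> complex^'k" where
  "complexify x = (\<chi> j. complex_of_real (x $ j))"

definition Re_vec :: "complex^'k \<Rightarrow> real^'k" where "Re_vec z = (\<chi> j. Re (z $ j))"
definition Im_vec :: "complex^'k \<Rightarrow> real^'k" where "Im_vec z = (\<chi> j. Im (z $ j))"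

lemma norm_complex_vec_power2: "(norm z)^2 = (norm (Re_vec z))^2 + (norm (Im_vec z))^2"
  by (simp add: norm_vec_def L2_set_def sum_nonneg Re_vec_def Im_vec_def cmod_power2 sum.distrib)

lemma Re_vec_complexify [simp]: "Re_vec (complexify x) = x"
  and Im_vec_complexify [simp]: "Im_vec (complexify x) = 0"
  by (simp_all add: vec_eq_iff Re_vec_def Im_vec_def complexify_def)

lemma cip_complexify: "cip z (complexify v) = Complex (Re_vec z \<bullet> v) (Im_vec z \<bullet> v)"
  by (simp add: complex_eq_iff cip_def complexify_def Re_vec_def Im_vec_def inner_vec_def)

text \<open>The real identity is applied to the real and imaginary parts separately.\<close>

lemma parseval_c_complexify:
  fixes f :: "'n::finite \<Rightarrow> real^'k::finite"
  assumes "parseval_r f"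
  shows "parseval_c (\<lambda>i. complexify (f i))"
  using assms
  by (simp add: parseval_c_def parseval_r_def cip_complexify cmod_power2 sum.distrib norm_complex_vec_power2)

lemma seidel_c_complexify:
  fixes f :: "'n::finite \<Rightarrow> real^'k::finite"
  shows "seidel_c (\<lambda>i. complexify (f i)) = cmat_of_real (seidel_r f)"
  by (simp add: vec_eq_iff seidel_c_nth cmat_of_real_def seidel_r_def gram_def cip_complexify
      matrix_matrix_mult_def analysis_r_def transpose_def inner_vec_def complex_eq_iff mult.commute)

definition real_partial_frame_op :: "('n \<Rightarrow> real^'k) \<Rightarrow> 'n set \<Rightarrow> real^'k \<Rightarrow> real^'k" where
  "real_partial_frame_op f A x = (\<Sum>i\<in>A. (x \<bullet> f i) *s f i)"

lemma analysis_sel_diag_eq_real_partial_frame_op: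
  fixes f :: "'n::finite \<Rightarrow> real^'k::finite"
  shows "(transpose (analysis_r f) ** sel_diag A ** analysis_r f) *v x = real_partial_frame_op f A x"
proof -
  have V: "analysis_r f *v x = (\<chi> i. x \<bullet> f i)"
    by (simp add: vec_eq_iff matrix_vector_mult_def analysis_r_def inner_vec_def mult.commute)
  have S: "sel_diag A *v y = (\<chi> i. if i \<in> A then y $ i else 0)" for y :: "real^'n"
    by (rule sel_diag_mult_vec)
  have "(transpose (analysis_r f) *v (sel_diag A *v (analysis_r f *v x))) $ j = real_partial_frame_op f A x $ j" for j
  proof -
    have "(transpose (analysis_r f) *v (sel_diag A *v (analysis_r f *v x))) $ j
        = (\<Sum>i\<in>UNIV. if i \<in> A then f i $ j * (x \<bullet> f i) else 0)"
      unfolding V S by (simp add: matrix_vector_mult_def transpose_def analysis_r_def)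
        (rule sum.cong, auto)
    also have "\<dots> = (\<Sum>i\<in>A. f i $ j * (x \<bullet> f i))"
      by (simp add: sum.If_cases)
    finally show ?thesis by (simp add: real_partial_frame_op_def mult.commute)
  qed
  then show ?thesis by (simp add: vec_eq_iff flip: matrix_vector_mul_assoc)
qed

lemma partial_frame_op_complexify:
  "Re_vec (partial_frame_op (\<lambda>i. complexify (f i)) A z) = real_partial_frame_op f A (Re_vec z)"
  "Im_vec (partial_frame_op (\<lambda>i. complexify (f i)) A z) = real_partial_frame_op f A (Im_vec z)"
  unfolding partial_frame_op_def real_partial_frame_op_def cip_complexify
  by (simp_all add: vec_eq_iff Re_vec_def Im_vec_def complexify_def)

lemma linear_real_partial_frame_op:
  fixes f :: "'n \<Rightarrow> real^'k::finite"
  shows "linear (real_partial_frame_op f A)"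
  by (rule linearI)
     (simp_all add: real_partial_frame_op_def inner_add_left sum.distrib vec_eq_iff
       sum_distrib_left algebra_simps)

text \<open>The complexified operator acts as the real one on real and imaginary parts. Real vectors
  give one inequality, and adding the squared norms of the two parts gives the other.\<close>

lemma onorm_real_partial_frame_op:
  fixes f :: "'n \<Rightarrow> real^'k::finite"
  shows "onorm (real_partial_frame_op f A) = block_norm (\<lambda>i. complexify (f i)) A"
proof (rule antisym)
  let ?T = "real_partial_frame_op f A" and ?C = "partial_frame_op (\<lambda>i. complexify (f i)) A"
  have blT: "bounded_linear ?T"
    using linear_real_partial_frame_op by (rule linear_conv_bounded_linear[THEN iffD1])
  have blC: "bounded_linear ?C"
    using linear_partial_frame_op by (rule linear_conv_bounded_linear[THEN iffD1])
  have norm_complexify: "norm (complexify x) = norm x" for x :: "real^'k"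
    using norm_complex_vec_power2[of "complexify x"] by (simp add: power2_eq_iff_nonneg)
  show "onorm ?T \<le> block_norm (\<lambda>i. complexify (f i)) A"
  proof (rule onorm_bound)
    show "0 \<le> block_norm (\<lambda>i. complexify (f i)) A"
      unfolding block_norm_def by (rule onorm_pos_le[OF blC])
    fix x :: "real^'k"
    have "(norm (?C (complexify x)))^2 = (norm (?T x))^2 + (norm (?T 0))^2"
      unfolding norm_complex_vec_power2[of "?C (complexify x)"] partial_frame_op_complexify by simp
    then have "norm (?C (complexify x)) = norm (?T x)"
      using linear_0[OF linear_real_partial_frame_op, of f A] by (simp add: power2_eq_iff_nonneg)
    then show "norm (?T x) \<le> block_norm (\<lambda>i. complexify (f i)) A * norm x"
      using onorm[OF blC, of "complexify x"] by (simp add: norm_complexify block_norm_def)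
  qed
  show "block_norm (\<lambda>i. complexify (f i)) A \<le> onorm ?T"
    unfolding block_norm_def
  proof (rule onorm_bound)
    show N: "0 \<le> onorm ?T" by (rule onorm_pos_le[OF blT])
    fix z :: "complex^'k"
    have le: "(norm (?T x))^2 \<le> (onorm ?T)^2 * (norm x)^2" for x
      using power_mono[OF onorm[OF blT, of x], of 2] by (simp add: power_mult_distrib)
    have "(norm (?C z))^2 = (norm (?T (Re_vec z)))^2 + (norm (?T (Im_vec z)))^2"
      unfolding norm_complex_vec_power2[of "?C z"] partial_frame_op_complexify ..
    also have "\<dots> \<le> (onorm ?T)^2 * (norm (Re_vec z))^2 + (onorm ?T)^2 * (norm (Im_vec z))^2"
      by (intro add_mono le)
    also have "\<dots> = (onorm ?T * norm z)^2"
      by (simp add: norm_complex_vec_power2[of z] power_mult_distrib distrib_left)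
    finally show "norm (?C z) \<le> onorm ?T * norm z"
      by (rule power2_le_imp_le) (simp add: N)
  qed
qed

lemma uniform_upto_c_complexify:
  fixes f :: "'n::finite \<Rightarrow> real^'k::finite"
  shows "uniform_upto_c m (\<lambda>i. complexify (f i)) \<longleftrightarrow> uniform_upto_r m f"
  unfolding uniform_upto_c_def uniform_upto_r_def uniform_c_iff_block_norm uniform_r_def
    analysis_sel_diag_eq_real_partial_frame_op onorm_real_partial_frame_op ..

theorem theorem3p14:
  assumes "CARD('k::finite) < CARD('n::finite)"
      and "CARD('k) \<noteq> 1" and "CARD('k) \<noteq> CARD('n) - 1"
  shows "(\<forall>f::'n \<Rightarrow> complex^'k. parseval_c f \<longrightarrow>
            (uniform_upto_c 4 f \<longleftrightarrow> switching_equiv (seidel_c f) seidel4))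
       \<and> (\<forall>f::'n \<Rightarrow> real^'k. parseval_r f \<longrightarrow>
            (uniform_upto_r 4 f \<longleftrightarrow> switching_equiv (cmat_of_real (seidel_r f)) seidel4))"
proof -
  have complex_case: "uniform_upto_c 4 f \<longleftrightarrow> switching_equiv (seidel_c f) seidel4"
    if "parseval_c f" for f :: "'n \<Rightarrow> complex^'k"
    using uniform_imp_switching_equiv[OF that assms] switching_equiv_imp_uniform[OF that assms(1,2)]
    by blast
  moreover have "uniform_upto_r 4 f \<longleftrightarrow> switching_equiv (cmat_of_real (seidel_r f)) seidel4"
    if "parseval_r f" for f :: "'n \<Rightarrow> real^'k"
    using complex_case[OF parseval_c_complexify[OF that]]
    unfolding uniform_upto_c_complexify seidel_c_complexify .
  ultimately show ?thesis by blast
qed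

end
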